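(* Let $\gamma=\{\gamma_{m,n}\}_{(m,n)\in\mathfrak N}$ be a sequence of complex numbers defined on $\mathfrak N$. Then the following statements are equivalent: (i) $\gamma$ is a determinate complex moment sequence with a representing measure $\mu$ such that $\mu(\{0\})=0$; (ii) $\mathsf{PDE}(\gamma)=\{\Gamma\}$ (a singleton) and $\Gamma$ has the property that $\mu_1=\mu_2$ whenever $(\mu_1,0)$ and $(\mu_2,0)$ are representing pairs for $\Gamma$; (iii) $\mathsf{PDE}(\gamma)=\{\Gamma\}$ (a singleton) and $\Gamma$ is determinate. Moreover, if $\Gamma$ is as in (iii), then $(\mu,0)$ is its representing pair, where $\mu$ is as in (i).
   Context: All measures are positive, and integrands are tacitly assumed to be absolutely integrable wherever integrals appear. Put $\mathbb C^*=\mathbb C\setminus\{0\}$, $\mathbb T=\{z\in\mathbb C:|z|=1\}$, $\mathfrak N=\{(m,n)\in\mathbb Z^2: m\ge 0,\ n\ge 0\}$ and $\mathfrak N_+=\{(m,n)\in\mathbb Z^2: m+n\ge 0\}$. Convention: $0^0=1$. A sequence $\gamma=\{\gamma_{m,n}\}_{(m,n)\in\mathfrak N}\subset\mathbb C$ is a complex moment sequence if there is a Borel measure $\mu$ on $\mathbb C$ with $\gamma_{m,n}=\int_{\mathbb C} z^m\bar z^n\,d\mu(z)$ for all $(m,n)\in\mathfrak N$; such $\mu$ is called a representing measure for $\gamma$. If $\mu$ is unique, $\gamma$ is called determinate. A sequence $\Gamma=\{\Gamma_{m,n}\}_{(m,n)\in\mathfrak N_+}\subset\mathbb C$ is positive definite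 on $\mathfrak N_+$ if $\sum_{(m,n),(p,q)\in\mathfrak N_+}\lambda_{m,n}\overline{\lambda_{p,q}}\,\Gamma_{m+q,n+p}\ge 0$ for every finitely supported family $\{\lambda_{m,n}\}_{(m,n)\in\mathfrak N_+}\subset\mathbb C$. $\mathsf{PDE}(\gamma)$ denotes the set of all sequences $\Gamma$ positive definite on $\mathfrak N_+$ with $\Gamma_{m,n}=\gamma_{m,n}$ for all $(m,n)\in\mathfrak N$. A representing pair for $\Gamma\colon\mathfrak N_+\to\mathbb C$ is a pair $(\mu,\nu)$ of Borel measures, $\mu$ on $\mathbb C^*$ and $\nu$ on $\mathbb T$, such that $\Gamma_{m,n}=\int_{\mathbb C^*}z^m\bar z^n\,d\mu(z)+\delta_{m+n,0}\int_{\mathbb T}z^m\bar z^n\,d\nu(z)$ for all $(m,n)\in\mathfrak N_+$, where $\delta_{k,l}$ is the Kronecker delta. If such a pair is unique, $\Gamma$ is called determinate. Borel measures on $\mathbb C^*$ are identified with Borel measures on $\mathbb C$ vanishing on $\{0\}$. *)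

theory Defs
  imports "HOL-Analysis.Analysis"
begin

definition NN :: "(int \<times> int) set" where
  "NN = {(m, n). 0 \<le> m \<and> 0 \<le> n}"

definition NN_plus :: "(int \<times> int) set" where
  "NN_plus = {(m, n). 0 \<le> m + n}"

(* On NN the exponents are nonnegative and 0 powi 0 = 1, which is the convention 0^0 = 1;
   negative exponents are only ever used away from the origin. *)
definition zmono :: "int \<Rightarrow> int \<Rightarrow> complex \<Rightarrow> complex" where
  "zmono m n z = z powi m * cnj z powi n"

(* Sequences are total functions on int \<times> int; only the values on NN matter here. *)
definition representing_measure :: "(int \<times> int \<Rightarrow> complex) \<Rightarrow> complex measure \<Rightarrow> bool" where
  "representing_measure \<gamma> \<mu> \<longleftrightarrow> sets \<mu> = sets borel \<and>
     (\<forall>(m, n) \<in> NN. integrable \<mu> (zmono m n) \<and> \<gamma> (m, n) = (LINT z|\<mu>. zmono m n z))"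

definition complex_moment_seq :: "(int \<times> int \<Rightarrow> complex) \<Rightarrow> bool" where
  "complex_moment_seq \<gamma> \<longleftrightarrow> (\<exists>\<mu>. representing_measure \<gamma> \<mu>)"

definition determinate_moment_seq :: "(int \<times> int \<Rightarrow> complex) \<Rightarrow> bool" where
  "determinate_moment_seq \<gamma> \<longleftrightarrow> complex_moment_seq \<gamma> \<and>
     (\<forall>\<mu>1 \<mu>2. representing_measure \<gamma> \<mu>1 \<and> representing_measure \<gamma> \<mu>2 \<longrightarrow> \<mu>1 = \<mu>2)"

(* nonneg_Reals as a set of complex numbers: the sum is real and nonnegative. *)
definition positive_definite :: "(int \<times> int \<Rightarrow> complex) \<Rightarrow> bool" where
  "positive_definite \<Gamma> \<longleftrightarrow>
     (\<forall>c :: int \<times> int \<Rightarrow> complex. let S = {x \<in> NN_plus. c x \<noteq> 0} in finite S \<longrightarrow>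
        (\<Sum>(m, n) \<in> S. \<Sum>(p, q) \<in> S. c (m, n) * cnj (c (p, q)) * \<Gamma> (m + q, n + p)) \<in> \<real>\<^sub>\<ge>\<^sub>0)"

(* Sequences indexed by NN_plus are represented by extensional functions,
   so that equality in PDE is equality on NN_plus. *)
definition PDE :: "(int \<times> int \<Rightarrow> complex) \<Rightarrow> (int \<times> int \<Rightarrow> complex) set" where
  "PDE \<gamma> = {\<Gamma> \<in> extensional NN_plus. positive_definite \<Gamma> \<and> (\<forall>x \<in> NN. \<Gamma> x = \<gamma> x)}"

abbreviation unit_circle :: "complex set" where
  "unit_circle \<equiv> sphere 0 1"

(* Borel measures on the punctured plane are Borel measures on the plane vanishing on {0};
   Borel measures on the unit circle live on its own Borel sigma-algebra. *)
definition representing_pair ::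
    "(int \<times> int \<Rightarrow> complex) \<Rightarrow> complex measure \<times> complex measure \<Rightarrow> bool" where
  "representing_pair \<Gamma> = (\<lambda>(\<mu>, \<nu>).
     sets \<mu> = sets borel \<and> emeasure \<mu> {0} = 0 \<and>
     sets \<nu> = sets (restrict_space borel unit_circle) \<and>
     (\<forall>(m, n) \<in> NN_plus.
        set_integrable \<mu> (- {0}) (zmono m n) \<and> integrable \<nu> (zmono m n) \<and>
        \<Gamma> (m, n) = (LINT z:- {0}|\<mu>. zmono m n z)
                  + (if m + n = 0 then 1 else 0) * (LINT z|\<nu>. zmono m n z)))"

definition determinate_on_NN_plus :: "(int \<times> int \<Rightarrow> complex) \<Rightarrow> bool" where
  "determinate_on_NN_plus \<Gamma> \<longleftrightarrow> (\<exists>!P. representing_pair \<Gamma> P)"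

abbreviation zero_circle_measure :: "complex measure" where
  "zero_circle_measure \<equiv> null_measure (restrict_space borel unit_circle)"

end

theory Submission
  imports Defs "HOL-Probability.Helly_Selection" "HOL-Probability.Probability_Mass_Function"
    "HOL-Computational_Algebra.Fundamental_Theorem_Algebra"
begin

text \<open>
  Everything rests on one existence theorem: a sequence \<Gamma> that is positive definite on the
  half plane m + n \<ge> 0 has a representing pair (\<mu>, \<nu>), and this pair can be chosen to come from a
  single measure \<rho> representing the restriction of \<Gamma> to the quadrant, with \<mu> the part of \<rho> off
  the origin and \<nu> of total mass \<rho>({0}) (lemma positive_definite_imp_representing_pair). So \<nu>
  distributes the atom at the origin over the directions in which the origin can be approached, and
  the quadrant sees only its total mass. The theorem is a reading of this picture.

  If \<gamma> is determinate with a measure \<mu> without atom at 0, every positive definite extension \<Gamma>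
  comes from some \<rho> representing \<gamma>; then \<rho> = \<mu>, hence \<nu> = 0, and \<Gamma> is the moment sequence of \<mu>.
  Conversely, suppose that \<Gamma> is the only extension. Replacing \<nu> by an atom of equal mass anywhere
  on the circle gives an extension again, and atoms at 1 and at \<i> give different values at (1, -1)
  unless \<nu> = 0. Applied to the pair obtained from an arbitrary representing measure of \<gamma>, this shows
  that all of them have no mass at 0 and are exactly the measures \<mu> for which (\<mu>, 0) represents \<Gamma>.
  Uniqueness of one kind of object is thus uniqueness of the other.

  For the existence theorem, polar coordinates z = r u with r real and u on the circle turn the
  monomials into r^k u^l with k = m + n and l = m - n, and extension by zero to those (k, l) of
  different parity gives a positive definite function G on the semigroup of all k \<ge> 0 and all integers l.
  Freezing u at one of N equally spaced angles and averaging over a square of frequencies (a Fejer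
  mean) gives real numbers that form a positive semidefinite Hankel matrix; after a small strictly
  positive perturbation Gauss quadrature represents the first 2N of them by a finite set of atoms. The
  union over the N angles is an atomic measure on the strip whose moments converge to G as N grows.
  A weak limit exists by Helly's selection theorem, which concerns the real line; a space-filling curve
  that maps the line onto the strip, with control at infinity, transports it to the strip. Convergence of
  moments survives because the next even moments are bounded.
\<close>

section \<open>Gauss quadrature\<close>

abbreviation complex_poly :: "real poly \<Rightarrow> complex poly" where
  "complex_poly \<equiv> map_poly complex_of_real"

lemma complex_poly_add: "complex_poly (p + q) = complex_poly p + complex_poly q"
  by (rule poly_eqI) (simp add: coeff_map_poly)

lemma complex_poly_smult: "complex_poly (smult a p) = smult (of_real a) (complex_poly p)"
  by (rule poly_eqI) (simp add: coeff_map_poly)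

lemma complex_poly_mult: "complex_poly (p * q) = complex_poly p * complex_poly q"
  by (induction p)
     (simp_all add: complex_poly_add complex_poly_smult map_poly_pCons mult_pCons_left)

lemma poly_complex_poly_of_real: "poly (complex_poly p) (of_real x) = of_real (poly p x)"
  by (induction p) (simp_all add: map_poly_pCons)

text \<open>
  The conjugate of a nonreal root of a real polynomial is a root too, and the factor belonging to the
  pair is written as a sum of two squares, which is what positivity can be played against.
\<close>

lemma nonreal_root_imp_quadratic_dvd:
  fixes P :: "real poly"
  assumes "poly (complex_poly P) z = 0" "Im z \<noteq> 0"
  shows "[:- Re z, 1:]^2 + [:(Im z)^2:] dvd P"
proof -
  define D :: "real poly" where "D = [:- Re z, 1:]^2 + [:(Im z)^2:]"
  have D: "D = [:(Re z)^2 + (Im z)^2, - 2 * Re z, 1:]"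
    by (simp add: D_def power2_eq_square)
  have degD: "degree D = 2" by (simp add: D)
  have Dz: "poly (complex_poly D) z = 0"
    by (simp add: D map_poly_pCons complex_eq_iff power2_eq_square algebra_simps)
  have "P mod D = 0"
  proof (rule ccontr)
    assume nz: "P mod D \<noteq> 0"
    have "D \<noteq> 0" using degD by auto
    hence "degree (P mod D) < 2" using degree_mod_less[of D P] degD nz by auto
    hence eq: "P mod D = [:coeff (P mod D) 0, coeff (P mod D) 1:]" (is "_ = [:?a, ?b:]")
      by (intro poly_eqI) (auto simp: coeff_pCons coeff_eq_0 split: nat.splits)
    have "poly (complex_poly (D * (P div D) + P mod D)) z = 0" using assms by simp
    hence "poly (complex_poly (P mod D)) z = 0"
      by (simp only: complex_poly_add complex_poly_mult poly_add poly_mult Dz mult_zero_left add_0)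
    hence "complex_of_real ?a + z * of_real ?b = 0"
      by (subst (asm) eq) (simp add: map_poly_pCons)
    hence "Im (complex_of_real ?a + z * of_real ?b) = 0" "Re (complex_of_real ?a + z * of_real ?b) = 0"
      by simp_all
    hence "?b = 0" "?a = 0" using assms(2) by auto
    thus False using eq nz by simp
  qed
  thus ?thesis by (simp add: D_def mod_eq_0_iff_dvd)
qed

text \<open>
  By the fundamental theorem of algebra a linear factor can be split off; it is real because real
  quadratic factors are excluded, and its root is lost for the cofactor because double factors are.
\<close>

lemma card_roots_eq_degree_of_real_simple_roots:
  fixes P :: "real poly"
  assumes "P \<noteq> 0"
    and "\<And>x. \<not> [:- x, 1:]^2 dvd P"
    and "\<And>x y. y \<noteq> 0 \<Longrightarrow> \<not> [:- x, 1:]^2 + [:y^2:] dvd P"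
  shows "card {x. poly P x = 0} = degree P"
  using assms
proof (induction "degree P" arbitrary: P)
  case 0
  then obtain c where "P = [:c:]" "c \<noteq> 0" by (metis degree_eq_zeroE pCons_0_0)
  thus ?case by simp
next
  case (Suc n)
  have "degree (complex_poly P) = Suc n"
    using Suc.hyps(2) by (simp add: degree_map_poly)
  then obtain z where z: "poly (complex_poly P) z = 0"
    using fundamental_theorem_of_algebra[of "complex_poly P"] by (auto simp: constant_degree)
  have "Im z = 0" using nonreal_root_imp_quadratic_dvd[OF z] Suc.prems(3) by blast
  hence "z = of_real (Re z)" by (simp add: complex_eq_iff)
  hence "poly P (Re z) = 0" using z poly_complex_poly_of_real[of P "Re z"] by simp
  then obtain Q where Q: "P = [:- Re z, 1:] * Q" by (auto simp: poly_eq_0_iff_dvd dvd_def)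
  define x where "x = Re z"
  have P: "P = [:- x, 1:] * Q" using Q by (simp add: x_def)
  have Q0: "Q \<noteq> 0" using Suc.prems(1) P by auto
  have dP: "degree P = Suc (degree Q)" unfolding P by (subst degree_mult_eq) (use Q0 in auto)
  have xQ: "poly Q x \<noteq> 0"
  proof
    assume "poly Q x = 0"
    hence "[:- x, 1:]^2 dvd P" unfolding P power2_eq_square
      by (intro mult_dvd_mono) (auto simp: poly_eq_0_iff_dvd)
    with Suc.prems(2) show False by blast
  qed
  have "card {x. poly Q x = 0} = degree Q"
  proof (rule Suc.hyps(1))
    show "\<not> [:- t, 1:]^2 dvd Q" for t
      using Suc.prems(2)[of t] dvd_mult[of "[:- t, 1:]^2" Q] unfolding P by blast
    show "\<not> [:- t, 1:]^2 + [:y^2:] dvd Q" if "y \<noteq> 0" for t y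
      using Suc.prems(3)[OF that, of t] dvd_mult[of "[:- t, 1:]^2 + [:y^2:]" Q] unfolding P by blast
  qed (use Suc.hyps(2) dP Q0 in auto)
  moreover have "{x. poly P x = 0} = insert x {x. poly Q x = 0}" by (auto simp: P)
  ultimately show ?case using xQ poly_roots_finite[OF Q0] dP by simp
qed

locale linear_functional_poly =
  fixes L :: "real poly \<Rightarrow> real"
  assumes L_add: "L (p + q) = L p + L q"
    and L_smult: "L (smult c p) = c * L p"
begin

lemma L_diff: "L (p - q) = L p - L q"
  using L_add[of "p - q" q] by simp

lemma L_zero: "L 0 = 0"
  using L_smult[of 0 0] by simp

lemma L_sum: "L (\<Sum>i\<in>A. f i) = (\<Sum>i\<in>A. L (f i))"
  by (induction A rule: infinite_finite_induct) (simp_all add: L_zero L_add)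

text \<open>
  Gram-Schmidt applied to the powers of x, for the inner product L (p q).
\<close>

lemma orthogonal_polynomial_exists:
  assumes pos: "\<And>p. p \<noteq> 0 \<Longrightarrow> degree p < n \<Longrightarrow> L (p * p) > 0"
  shows "m \<le> n \<Longrightarrow> \<exists>P. degree P = m \<and> lead_coeff P = 1 \<and> (\<forall>q. degree q < m \<longrightarrow> L (P * q) = 0)"
proof (induction m rule: less_induct)
  case (less m)
  have "\<forall>k\<in>{..<m}. \<exists>P. degree P = k \<and> lead_coeff P = 1 \<and> (\<forall>q. degree q < k \<longrightarrow> L (P * q) = 0)"
    using less by auto
  then obtain P where P: "\<And>k. k < m \<Longrightarrow> degree (P k) = k" "\<And>k. k < m \<Longrightarrow> lead_coeff (P k) = 1"
    "\<And>k q. k < m \<Longrightarrow> degree q < k \<Longrightarrow> L (P k * q) = 0"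
    by (metis lessThan_iff)
  have Ppos: "L (P k * P k) > 0" if "k < m" for k
    using that P(1,2)[of k] less.prems by (intro pos) auto
  have orth: "L (P k * P j) = 0" if "k < m" "j < m" "j \<noteq> k" for j k
    using that P(3)[of k "P j"] P(3)[of j "P k"] P(1) by (cases "j < k") (auto simp: mult.commute)
  define R where "R = (\<Sum>k<m. smult (L (monom 1 m * P k) / L (P k * P k)) (P k))"
  define Q where "Q = monom 1 m - R"
  have degR: "degree R < m \<or> R = 0"
  proof (cases "m = 0")
    case False
    have "degree R \<le> m - 1" unfolding R_def
      by (intro degree_sum_le) (use P(1) False in \<open>auto intro: order.trans[OF degree_smult_le]\<close>)
    with False show ?thesis by auto
  qed (simp add: R_def)
  have cR: "coeff R m = 0" using degR by (auto simp: coeff_eq_0)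
  have degQ: "degree Q = m"
  proof (rule antisym)
    show "degree Q \<le> m" unfolding Q_def using degR
      by (intro degree_diff_le) (auto simp: degree_monom_eq)
    show "m \<le> degree Q" by (rule le_degree) (simp add: Q_def cR)
  qed
  have lcQ: "lead_coeff Q = 1" by (simp add: degQ) (simp add: Q_def cR)
  have QP: "L (Q * P j) = 0" if j: "j < m" for j
  proof -
    have "L (R * P j) = (\<Sum>k<m. (L (monom 1 m * P k) / L (P k * P k)) * L (P k * P j))"
      by (simp add: R_def sum_distrib_right L_sum L_smult)
    also have "\<dots> = (\<Sum>k<m. if k = j then L (monom 1 m * P j) else 0)"
      using j orth Ppos by (intro sum.cong) (auto simp: less_imp_neq[symmetric])
    also have "\<dots> = L (monom 1 m * P j)" using j by simp
    finally show ?thesis by (simp add: Q_def left_diff_distrib L_diff)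
  qed
  have "L (Q * q) = 0" if "degree q < m" for q
    using that
  proof (induction "degree q" arbitrary: q rule: less_induct)
    case (less q)
    define d where "d = degree q"
    have d: "d < m" using less by (simp add: d_def)
    define r where "r = q - smult (lead_coeff q) (P d)"
    have q: "q = r + smult (lead_coeff q) (P d)" by (simp add: r_def)
    have "L (Q * r) = 0"
    proof (cases "r = 0")
      case False
      have "degree r \<le> d" unfolding r_def
        by (intro degree_diff_le) (use P(1)[OF d] in \<open>auto simp: d_def\<close>)
      moreover have "coeff r d = 0" using P(1,2)[OF d] by (simp add: r_def d_def)
      ultimately have "degree r < d" using False
        by (metis le_neq_implies_less leading_coeff_0_iff)
      thus ?thesis using less(1)[of r] d by (simp add: d_def)
    qed (simp add: L_zero)
    moreover have "Q * q = Q * r + smult (lead_coeff q) (Q * P d)"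
      by (subst q) (simp add: distrib_left)
    ultimately show ?case by (simp add: L_add L_smult QP[OF d])
  qed
  with degQ lcQ show ?case by blast
qed

text \<open>
  The nodes are the roots of the orthogonal polynomial P of degree n. Positivity makes them real and simple:
  if P = Q (x - a)^2, then 0 = L (P Q) is the value of L at the nonzero square ((x - a) Q)^2, and if
  P = Q ((x - a)^2 + b^2), then 0 = L (P Q) is a sum of two such values. Interpolation at the n nodes is
  exact in degree below n, and division by P extends exactness to degree below 2 n because L
  annihilates the multiples of P that occur. Exactness at the squares of the Lagrange polynomials
  makes the weights nonnegative.
\<close>

theorem Gauss_quadrature:
  assumes pos: "\<And>p. p \<noteq> 0 \<Longrightarrow> degree p < n \<Longrightarrow> L (p * p) > 0"
  shows "\<exists>T w. finite T \<and> (\<forall>t\<in>T. w t \<ge> 0) \<and>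
           (\<forall>q. degree q < 2 * n \<longrightarrow> L q = (\<Sum>t\<in>T. w t * poly q t))"
proof (cases "n = 0")
  case True
  thus ?thesis by (intro exI[of _ "{}"]) auto
next
  case n: False
  obtain P where P: "degree P = n" "lead_coeff P = 1" "\<And>q. degree q < n \<Longrightarrow> L (P * q) = 0"
    using orthogonal_polynomial_exists[OF pos, of n] by blast
  have P0: "P \<noteq> 0" using P(2) by auto
  define T where "T = {x. poly P x = 0}"
  have finT: "finite T" unfolding T_def using P0 by (rule poly_roots_finite)
  have linear_mult: "[:- x, 1:] * Q \<noteq> 0 \<and> degree ([:- x, 1:] * Q) = Suc (degree Q)"
    if "Q \<noteq> 0" for x :: real and Q
    using that by (subst degree_mult_eq) (auto simp del: mult_pCons_left)
  have no_double: "\<not> [:- x, 1:]^2 dvd P" for x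
  proof
    assume "[:- x, 1:]^2 dvd P"
    then obtain Q where Q: "P = [:- x, 1:]^2 * Q" by (rule dvdE)
    have Q0: "Q \<noteq> 0" using P0 Q by auto
    have dQ: "degree P = 2 + degree Q" unfolding Q
      by (subst degree_mult_eq) (use Q0 in \<open>auto simp: degree_power_eq\<close>)
    have "L (([:- x, 1:] * Q) * ([:- x, 1:] * Q)) > 0"
      using dQ P(1) linear_mult[OF Q0, of x] by (intro pos) linarith+
    also have "([:- x, 1:] * Q) * ([:- x, 1:] * Q) = P * Q"
      unfolding Q by (simp only: power2_eq_square mult_ac)
    finally show False using P(3)[of Q] dQ P(1) by simp
  qed
  have no_quad: "\<not> [:- x, 1:]^2 + [:y^2:] dvd P" if y: "y \<noteq> 0" for x y
  proof
    assume "[:- x, 1:]^2 + [:y^2:] dvd P"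
    then obtain Q where Q: "P = ([:- x, 1:]^2 + [:y^2:]) * Q" by (rule dvdE)
    have Q0: "Q \<noteq> 0" using P0 Q by auto
    have "degree ([:- x, 1:]^2 + [:y^2:]) = 2"
      by (simp add: power2_eq_square)
    hence dQ: "degree P = 2 + degree Q" unfolding Q
      by (subst degree_mult_eq) (use Q0 in auto)
    have "L (([:- x, 1:] * Q) * ([:- x, 1:] * Q)) > 0"
      using dQ P(1) linear_mult[OF Q0, of x] by (intro pos) linarith+
    moreover have "L (Q * Q) > 0" using Q0 dQ P(1) by (intro pos) auto
    moreover have "P * Q = ([:- x, 1:] * Q) * ([:- x, 1:] * Q) + smult (y^2) (Q * Q)"
    proof -
      have "(X^2 + Y) * Q * Q = (X * Q) * (X * Q) + Y * (Q * Q)" for X Y :: "real poly"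
        by (simp add: power2_eq_square algebra_simps)
      from this[of "[:- x, 1:]" "[:y^2:]"] show ?thesis unfolding Q by simp
    qed
    hence "L (P * Q) = L (([:- x, 1:] * Q) * ([:- x, 1:] * Q)) + y^2 * L (Q * Q)"
      by (simp only: L_add L_smult)
    ultimately show False using P(3)[of Q] dQ P(1) y
      by (smt (verit) mult_pos_pos zero_less_power2 less_add_same_cancel2 pos2)
  qed
  have cardT: "card T = n" unfolding T_def P(1)[symmetric]
    by (rule card_roots_eq_degree_of_real_simple_roots[OF P0 no_double no_quad])
  \<comment> \<open>The Lagrange basis polynomials of the nodes.\<close>
  define l where "l t = (\<Prod>s\<in>T - {t}. smult (1 / (t - s)) [:- s, 1:])" for t
  have l: "poly (l t) s = (if s = t then 1 else 0)" if "t \<in> T" "s \<in> T" for s t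
  proof (cases "s = t")
    case True
    have "poly (l t) t = (\<Prod>u\<in>T - {t}. t / (t - u) - u / (t - u))"
      by (simp add: l_def poly_prod)
    also have "\<dots> = (\<Prod>u\<in>T - {t}. 1)"
      by (intro prod.cong) (auto simp flip: diff_divide_distrib)
    finally show ?thesis using True by simp
  next
    case False
    have "(\<Prod>u\<in>T - {t}. poly (smult (1 / (t - u)) [:- u, 1:]) s) = 0"
      by (rule prod_zero) (use False that finT in auto)
    thus ?thesis using False by (simp add: l_def poly_prod)
  qed
  have degl: "degree (l t) < n" if "t \<in> T" for t
  proof -
    have "degree (l t) \<le> sum (degree \<circ> (\<lambda>s. smult (1 / (t - s)) [:- s, 1:])) (T - {t})"
      unfolding l_def using finT by (intro degree_prod_sum_le) auto
    also have "\<dots> \<le> (\<Sum>s\<in>T - {t}. 1)"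
      by (intro sum_mono) auto
    also have "\<dots> < n" using that finT cardT n by (simp add: card_Diff_singleton)
    finally show ?thesis .
  qed
  have interp: "b = (\<Sum>t\<in>T. smult (poly b t) (l t))" if "degree b < n" for b
  proof (rule poly_eqI_degree[of T])
    fix x assume x: "x \<in> T"
    have "poly (\<Sum>t\<in>T. smult (poly b t) (l t)) x = (\<Sum>t\<in>T. poly b t * poly (l t) x)"
      by (simp add: poly_sum)
    also have "\<dots> = (\<Sum>t\<in>T. if x = t then poly b t else 0)"
      using x l by (intro sum.cong) auto
    finally show "poly b x = poly (\<Sum>t\<in>T. smult (poly b t) (l t)) x" using x finT by simp
  next
    have "degree (\<Sum>t\<in>T. smult (poly b t) (l t)) \<le> n - 1"
    proof (rule degree_sum_le[OF finT])
      fix t assume "t \<in> T"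
      thus "degree (smult (poly b t) (l t)) \<le> n - 1"
        using degl[of t] degree_smult_le[of "poly b t" "l t"] by linarith
    qed
    thus "degree (\<Sum>t\<in>T. smult (poly b t) (l t)) < card T" using n cardT by simp
  qed (use that cardT in auto)
  have quad: "L q = (\<Sum>t\<in>T. L (l t) * poly q t)" if q: "degree q < 2 * n" for q
  proof -
    define a b where "a = q div P" and "b = q mod P"
    have qab: "q = P * a + b" by (simp add: a_def b_def)
    have degb: "degree b < n" using degree_mod_less[OF P0, of q] P(1) n by (auto simp: b_def)
    have dega: "degree a < n"
    proof (cases "a = 0")
      case False
      have "degree (P * a) = n + degree a" using False P0 P(1) by (simp add: degree_mult_eq)
      moreover have "degree (P * a) \<le> max (degree q) (degree b)"
        using degree_diff_le_max[of q b] qab by simp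
      ultimately show ?thesis using q degb by linarith
    qed (use n in simp)
    have "L q = L b" using P(3)[OF dega] by (simp add: qab L_add)
    also have "\<dots> = L (\<Sum>t\<in>T. smult (poly b t) (l t))" by (rule arg_cong[OF interp[OF degb]])
    also have "\<dots> = (\<Sum>t\<in>T. L (l t) * poly b t)" by (simp add: L_sum L_smult mult.commute)
    also have "\<dots> = (\<Sum>t\<in>T. L (l t) * poly q t)"
      by (intro sum.cong) (auto simp: qab T_def)
    finally show ?thesis .
  qed
  have "L (l t) \<ge> 0" if t: "t \<in> T" for t
  proof -
    have l0: "l t \<noteq> 0" using l[OF t t] by auto
    have "L (l t * l t) = (\<Sum>s\<in>T. L (l s) * poly (l t * l t) s)"
      using degl[OF t] degree_mult_le[of "l t" "l t"] by (intro quad) linarith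
    also have "\<dots> = (\<Sum>s\<in>T. if s = t then L (l t) else 0)" using l t by (intro sum.cong) auto
    also have "\<dots> = L (l t)" using t finT by simp
    finally show ?thesis using pos[OF l0 degl[OF t]] by simp
  qed
  with quad finT show ?thesis
    by (intro exI[of _ T] exI[of _ "\<lambda>t. L (l t)"]) auto
qed

end

section \<open>A space-filling curve of the strip\<close>

text \<open>
  The 2-periodic zigzag that is t on [0, 1] and 2 - t on [1, 2]; this form makes continuity and
  periodicity immediate.
\<close>

definition triangle_wave :: "real \<Rightarrow> real" where
  "triangle_wave t = arccos (cos (pi * t)) / pi"

lemma triangle_wave_id: "0 \<le> t \<Longrightarrow> t \<le> 1 \<Longrightarrow> triangle_wave t = t"
  unfolding triangle_wave_def by (subst arccos_cos) auto

lemma triangle_wave_periodic: "triangle_wave (t + 2 * of_int i) = triangle_wave t"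
proof -
  have "cos (pi * (t + 2 * of_int i)) = cos (pi * t)"
    using cos.plus_of_int[of "pi * t" i] by (simp add: algebra_simps)
  thus ?thesis by (simp add: triangle_wave_def)
qed

lemma continuous_triangle_wave: "continuous_on A triangle_wave"
  unfolding triangle_wave_def by (intro continuous_intros) auto

text \<open>
  Continuous, 2-periodic, 0 on [0, 1/3] and 1 on [2/3, 1]. At 3^k s it reads off whether the k-th ternary
  digit of a point s of the Cantor set is 0 or 2.
\<close>

definition ternary_digit :: "real \<Rightarrow> real" where
  "ternary_digit t = max 0 (min 1 (3 * triangle_wave t - 1))"

lemma ternary_digit_bounds: "0 \<le> ternary_digit t" "ternary_digit t \<le> 1"
  by (auto simp: ternary_digit_def)

lemma continuous_ternary_digit: "continuous_on A ternary_digit"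
  unfolding ternary_digit_def by (intro continuous_intros continuous_triangle_wave)

lemma ternary_digit_periodic: "ternary_digit (t + 2 * of_int i) = ternary_digit t"
  by (simp add: ternary_digit_def triangle_wave_periodic)

text \<open>
  Take s to be the Cantor point with ternary digits 2 c k. Multiplying by 3^k shifts the digits and leaves
  an even integer in front, which the period 2 removes.
\<close>

lemma ternary_digit_expansion:
  fixes c :: "nat \<Rightarrow> real"
  assumes c: "\<And>k. c k \<in> {0, 1}"
  shows "\<exists>s. 0 \<le> s \<and> s \<le> 1 \<and> (\<forall>k. ternary_digit (3 ^ k * s) = c k)"
proof -
  have c01: "0 \<le> c k" "c k \<le> 1" for k using c[of k] by auto
  have geom: "(\<lambda>j. a * (1/3) ^ j) sums (a * (3/2))" for a :: real
    using sums_mult[OF geometric_sums[of "1/3::real"], of a] by simp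
  have summ: "summable (\<lambda>j. 2 * c (k + j) / 3 ^ Suc j)" for k
    by (rule summable_comparison_test'[OF sums_summable[OF geom[of "2/3"]], of 0])
       (use c01 in \<open>auto simp: divide_simps power_divide\<close>)
  \<comment> \<open>The tail of the ternary expansion from position k on, shifted back to the unit interval.\<close>
  define s where "s k = (\<Sum>j. 2 * c (k + j) / 3 ^ Suc j)" for k
  have s01: "0 \<le> s k \<and> s k \<le> 1" for k
  proof
    show "0 \<le> s k" unfolding s_def by (intro suminf_nonneg summ) (use c01 in auto)
    have "s k \<le> (\<Sum>j. (2/3) * (1/3) ^ j)" unfolding s_def
      by (intro suminf_le summ sums_summable[OF geom])
         (use c01 in \<open>auto simp: divide_simps power_divide\<close>)
    also have "\<dots> = 1" using geom[of "2/3"] by (simp add: sums_iff)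
    finally show "s k \<le> 1" .
  qed
  have step: "3 * s k = 2 * c k + s (Suc k)" for k
  proof -
    have "s k = 2 * c k / 3 + (\<Sum>j. 2 * c (k + Suc j) / 3 ^ Suc (Suc j))"
      unfolding s_def by (subst suminf_split_head[OF summ]) (simp add: algebra_simps)
    also have "(\<Sum>j. 2 * c (k + Suc j) / 3 ^ Suc (Suc j)) = (\<Sum>j. (1/3) * (2 * c (Suc k + j) / 3 ^ Suc j))"
      by simp
    also have "\<dots> = (1/3) * s (Suc k)" unfolding s_def by (rule suminf_mult[OF summ])
    finally show ?thesis by simp
  qed
  have shift: "\<exists>i::int. 3 ^ k * s 0 = s k + 2 * of_int i" for k
  proof (induction k)
    case 0
    show ?case by (rule exI[of _ 0]) simp
  next
    case (Suc k)
    then obtain i :: int where i: "3 ^ k * s 0 = s k + 2 * of_int i" by blast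
    obtain d :: int where d: "c k = of_int d" using c[of k] by (metis insertE of_int_0 of_int_1 singletonD)
    have "3 ^ Suc k * s 0 = 3 * (3 ^ k * s 0)" by simp
    also have "\<dots> = s (Suc k) + 2 * of_int (d + 3 * i)"
      unfolding i using step[of k] d by (simp add: algebra_simps)
    finally show ?case by blast
  qed
  have "ternary_digit (3 ^ k * s 0) = c k" for k
  proof -
    obtain i :: int where "3 ^ k * s 0 = s k + 2 * of_int i" using shift by blast
    hence "ternary_digit (3 ^ k * s 0) = ternary_digit (s k)" by (simp add: ternary_digit_periodic)
    also have "\<dots> = c k"
      using c[of k] step[of k] s01[of k] s01[of "Suc k"]
      by (auto simp: ternary_digit_def triangle_wave_id)
    finally show ?thesis .
  qed
  with s01 show ?thesis by blast
qed

text \<open>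
  Below 1 the digits are the increments of the floors of 2^n x, and the series telescopes; x = 1 needs
  the expansion with all digits 1.
\<close>

lemma binary_expansion:
  fixes x :: real
  assumes "0 \<le> x" "x \<le> 1"
  shows "\<exists>a::nat \<Rightarrow> real. (\<forall>n. a n \<in> {0, 1}) \<and> (\<lambda>n. a n / 2 ^ Suc n) sums x"
proof (cases "x = 1")
  case True
  have "(\<lambda>n. 1 / 2 ^ Suc n) sums (1::real)"
    using power_half_series by (simp add: power_one_over divide_simps)
  thus ?thesis using True by (intro exI[of _ "\<lambda>_. 1"]) simp
next
  case False
  define u where "u n = \<lfloor>2 ^ n * x\<rfloor>" for n
  define a where "a n = real_of_int (u (Suc n) - 2 * u n)" for n
  have "a n \<in> {0, 1}" for n
  proof -
    have "u (Suc n) = \<lfloor>2 * (2 ^ n * x)\<rfloor>" by (simp add: u_def mult_ac)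
    hence "u (Suc n) - 2 * u n = 0 \<or> u (Suc n) - 2 * u n = 1" unfolding u_def by linarith
    thus ?thesis by (auto simp: a_def)
  qed
  moreover have "(\<lambda>n. a n / 2 ^ Suc n) sums x"
  proof -
    have "(\<lambda>n. real_of_int (u n) / 2 ^ n) \<longlonglongrightarrow> x"
    proof (rule tendsto_sandwich)
      show "\<forall>\<^sub>F n in sequentially. x - (1/2) ^ n \<le> real_of_int (u n) / 2 ^ n"
      proof (rule always_eventually, rule allI)
        fix n
        have "2 ^ n * x - 1 \<le> real_of_int (u n)" unfolding u_def by linarith
        hence "(2 ^ n * x - 1) / 2 ^ n \<le> real_of_int (u n) / 2 ^ n"
          by (rule divide_right_mono) simp
        thus "x - (1/2) ^ n \<le> real_of_int (u n) / 2 ^ n"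
          by (simp add: diff_divide_distrib power_one_over)
      qed
      show "\<forall>\<^sub>F n in sequentially. real_of_int (u n) / 2 ^ n \<le> x"
        by (rule always_eventually) (auto simp: u_def field_simps)
      have "(\<lambda>n. x - (1/2) ^ n) \<longlonglongrightarrow> x - 0"
        by (intro tendsto_intros LIMSEQ_power_zero) auto
      thus "(\<lambda>n. x - (1/2) ^ n) \<longlonglongrightarrow> x" by simp
    qed auto
    note telescope_sums[OF this]
    moreover have u0: "u 0 = 0" using assms False by (simp add: u_def floor_eq_iff)
    ultimately have "(\<lambda>n. real_of_int (u (Suc n)) / 2 ^ Suc n - real_of_int (u n) / 2 ^ n) sums x"
      by simp
    moreover have "real_of_int (u (Suc n)) / 2 ^ Suc n - real_of_int (u n) / 2 ^ n = a n / 2 ^ Suc n" for n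
      by (simp add: a_def field_simps)
    ultimately show ?thesis by simp
  qed
  ultimately show ?thesis by blast
qed

text \<open>
  Schoenberg's curve: the coordinates for q = 1 and q = 3 use the even and the odd ternary digits of s
  as binary digits.
\<close>

definition schoenberg :: "real \<Rightarrow> real \<Rightarrow> real" where
  "schoenberg q s = (\<Sum>n. ternary_digit (q * 9 ^ n * s) / 2 ^ Suc n)"

lemma continuous_schoenberg: "continuous_on UNIV (schoenberg q)"
proof -
  have "uniform_limit UNIV (\<lambda>n s. \<Sum>i<n. ternary_digit (q * 9 ^ i * s) / 2 ^ Suc i)
          (\<lambda>s. \<Sum>i. ternary_digit (q * 9 ^ i * s) / 2 ^ Suc i) sequentially"
  proof (rule Weierstrass_m_test)
    show "norm (ternary_digit (q * 9 ^ n * s) / 2 ^ Suc n) \<le> (1/2) ^ Suc n" for n s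
      using ternary_digit_bounds[of "q * 9 ^ n * s"] by (simp add: divide_simps power_divide)
    show "summable (\<lambda>n. (1/2::real) ^ Suc n)"
      using power_half_series sums_summable by blast
  qed
  moreover have "continuous_on UNIV (\<lambda>s. \<Sum>i<n. ternary_digit (q * 9 ^ i * s) / 2 ^ Suc i)" for n
    by (intro continuous_intros continuous_on_compose2[OF continuous_ternary_digit[of UNIV]]) auto
  ultimately have "continuous_on UNIV (\<lambda>s. \<Sum>i. ternary_digit (q * 9 ^ i * s) / 2 ^ Suc i)"
    by (intro uniform_limit_theorem[of _ _ sequentially]) auto
  thus ?thesis by (simp add: schoenberg_def[abs_def])
qed

lemma schoenberg_periodic: "schoenberg (of_int p) (s + 2 * of_int i) = schoenberg (of_int p) s"
proof -
  have "ternary_digit (of_int p * 9 ^ n * (s + 2 * of_int i)) = ternary_digit (of_int p * 9 ^ n * s)" for n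
    using ternary_digit_periodic[of "of_int p * 9 ^ n * s" "p * 9 ^ n * i"]
    by (simp add: algebra_simps)
  thus ?thesis by (simp add: schoenberg_def)
qed

lemma schoenberg_surj_square:
  assumes "0 \<le> x" "x \<le> 1" "0 \<le> y" "y \<le> 1"
  shows "\<exists>s. 0 \<le> s \<and> s \<le> 1 \<and> schoenberg 1 s = x \<and> schoenberg 3 s = y"
proof -
  obtain a b :: "nat \<Rightarrow> real" where
    a: "\<And>n. a n \<in> {0, 1}" "(\<lambda>n. a n / 2 ^ Suc n) sums x" and
    b: "\<And>n. b n \<in> {0, 1}" "(\<lambda>n. b n / 2 ^ Suc n) sums y"
    using binary_expansion[OF assms(1,2)] binary_expansion[OF assms(3,4)] by blast
  define c where "c k = (if even k then a (k div 2) else b (k div 2))" for k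
  have "c k \<in> {0, 1}" for k using a(1) b(1) by (simp add: c_def)
  then obtain s where s: "0 \<le> s" "s \<le> 1" "\<And>k. ternary_digit (3 ^ k * s) = c k"
    using ternary_digit_expansion[of c] by blast
  have "ternary_digit (1 * 9 ^ n * s) = a n" "ternary_digit (3 * 9 ^ n * s) = b n" for n
    using s(3)[of "2 * n"] s(3)[of "Suc (2 * n)"] by (auto simp: c_def power_mult)
  hence "schoenberg 1 s = x" "schoenberg 3 s = y"
    unfolding schoenberg_def using a(2) b(2) by (simp_all only: sums_iff)
  with s show ?thesis by blast
qed

text \<open>
  Helly's theorem will be applied on the real line, and this curve carries the limit measure to the
  product of the line with [0, 1]. The first coordinate R is a continuous staircase with one unit step in every
  period of length 2, plus Schoenberg's coordinate, so that on the flat piece over [2 i, 2 i + 1] the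
  curve fills [i, i + 1] times [0, 1]. The bound on s lets tightness in r pass to tightness in s.
\<close>

lemma space_filling_curve_strip:
  obtains R Y :: "real \<Rightarrow> real"
  where "continuous_on UNIV R" "continuous_on UNIV Y"
    and "\<And>r y. 0 \<le> y \<Longrightarrow> y \<le> 1 \<Longrightarrow> \<exists>s. R s = r \<and> Y s = y \<and> \<bar>s\<bar> \<le> 2 * \<bar>r\<bar> + 3"
proof
  define R where "R s = (s - triangle_wave s) / 2 + schoenberg 1 s" for s
  show "continuous_on UNIV R" unfolding R_def
    by (intro continuous_intros continuous_schoenberg continuous_triangle_wave) auto
  show "continuous_on UNIV (schoenberg 3)" by (rule continuous_schoenberg)
  fix r y :: real assume y: "0 \<le> y" "y \<le> 1"
  define i where "i = \<lfloor>r\<rfloor>"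
  have "0 \<le> r - of_int i" "r - of_int i \<le> 1" unfolding i_def by linarith+
  from schoenberg_surj_square[OF this y] obtain t where
    t: "0 \<le> t" "t \<le> 1" "schoenberg 1 t = r - of_int i" "schoenberg 3 t = y" by blast
  define s where "s = t + 2 * of_int i"
  have "R s = r" using t schoenberg_periodic[of 1 t i]
    by (simp add: R_def s_def triangle_wave_periodic triangle_wave_id)
  moreover have "schoenberg 3 s = y" using t schoenberg_periodic[of 3 t i] by (simp add: s_def)
  moreover have "\<bar>s\<bar> \<le> 2 * \<bar>r\<bar> + 3" unfolding s_def i_def using t by linarith
  ultimately show "\<exists>s. R s = r \<and> schoenberg 3 s = y \<and> \<bar>s\<bar> \<le> 2 * \<bar>r\<bar> + 3" by blast
qed

section \<open>Weak limits of atomic measures on the strip\<close>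

text \<open>
  The factor 1 / (1 + (d x)^2) is a smooth truncation: it makes x bounded, and what it removes from x
  is at most a small multiple of x^2.
\<close>

lemma cutoff_bounds:
  fixes x d :: real
  assumes "d > 0" "x \<ge> 0"
  shows "x / (1 + (d * x)^2) \<le> 1 / (2 * d)"
    and "\<bar>x - x / (1 + (d * x)^2)\<bar> \<le> d * x^2 / 2"
    and "x^2 / (1 + (d * x)^2) \<le> 1 / d^2"
    and "x^2 / (1 + (d * x)^2) \<le> x^2"
proof -
  have pos: "1 + (d * x)^2 > 0" by (simp add: add_pos_nonneg)
  have amgm: "2 * (d * x) \<le> 1 + (d * x)^2"
    using zero_le_power2[of "1 - d * x"] by (simp add: power2_diff)
  have s: "d * x / (1 + (d * x)^2) \<le> 1 / 2"
    using amgm pos by (simp add: divide_simps)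
  have "x / (1 + (d * x)^2) = (d * x / (1 + (d * x)^2)) / d" using assms by simp
  also have "\<dots> \<le> (1 / 2) / d" using s assms by (intro divide_right_mono) auto
  finally show "x / (1 + (d * x)^2) \<le> 1 / (2 * d)" by simp
  have "x - x / (1 + (d * x)^2) = (d * x^2) * (d * x / (1 + (d * x)^2))"
    using pos by (simp add: divide_simps) (simp add: power2_eq_square algebra_simps)
  moreover have "\<dots> \<le> (d * x^2) * (1 / 2)" using s assms by (intro mult_left_mono) auto
  moreover have "0 \<le> (d * x^2) * (d * x / (1 + (d * x)^2))" using assms pos by simp
  ultimately show "\<bar>x - x / (1 + (d * x)^2)\<bar> \<le> d * x^2 / 2" by simp
  have "(d * x)^2 / (1 + (d * x)^2) \<le> 1" using pos by (simp add: divide_simps)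
  hence "(d * x)^2 / (1 + (d * x)^2) / d^2 \<le> 1 / d^2" by (intro divide_right_mono) auto
  thus "x^2 / (1 + (d * x)^2) \<le> 1 / d^2" using assms by (simp add: power_mult_distrib)
  have "x^2 / (1 + (d * x)^2) \<le> x^2 / 1" by (intro divide_left_mono) (auto simp: add_pos_nonneg)
  thus "x^2 / (1 + (d * x)^2) \<le> x^2" by simp
qed

text \<open>
  Weak convergence only handles bounded integrands. Truncating f to f / (1 + (d |f|)^2) makes it
  bounded, with an error of at most d C / 2 for all measures simultaneously; Fatou's lemma transfers the
  second moment bound to the limit measure.
\<close>

lemma weak_conv_integral_of_bounded_second_moments:
  fixes f :: "real \<Rightarrow> complex"
  assumes M: "\<And>n. real_distribution (M n)" "real_distribution M'" "weak_conv_m M M'"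
    and cont: "continuous_on UNIV f"
    and int: "\<And>n. integrable (M n) (\<lambda>x. norm (f x)^2)"
    and bound: "\<And>n. (LINT x|M n. norm (f x)^2) \<le> C"
  shows "integrable M' f" "(\<lambda>n. LINT x|M n. f x) \<longlonglongrightarrow> (LINT x|M'. f x)"
proof -
  interpret M: real_distribution "M n" for n by fact
  interpret M': real_distribution M' by fact
  have C0: "0 \<le> C"
  proof -
    have "0 \<le> (LINT x|M 0. norm (f x)^2)" by simp
    with bound[of 0] show ?thesis by linarith
  qed
  have isCont: "isCont f x" for x using cont continuous_on_eq_continuous_at by blast
  have [measurable]: "f \<in> borel_measurable borel" using cont by (rule borel_measurable_continuous_onI)
  define h where "h d x = 1 + (d * norm (f x))^2" for d x
  have hpos: "h d x > 0" for d x by (simp add: h_def add_pos_nonneg)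
  have conth: "isCont (h d) x" for d x unfolding h_def by (intro continuous_intros isCont)
  have hm[measurable]: "h d \<in> borel_measurable borel" for d unfolding h_def by measurable
  define g where "g d x = f x / complex_of_real (h d x)" for d x
  have gm[measurable]: "g d \<in> borel_measurable borel" for d unfolding g_def by measurable
  have normg: "norm (g d x) = norm (f x) / h d x" for d x
    using hpos[of d x] by (simp add: g_def norm_divide)
  have g_bdd: "norm (g d x) \<le> 1 / (2 * d)" if "d > 0" for d x
    using cutoff_bounds(1)[OF that, of "norm (f x)"] by (simp add: normg h_def)
  have g_diff: "norm (f x - g d x) \<le> d / 2 * norm (f x)^2" if "d > 0" for d x
  proof -
    have "f x - g d x = complex_of_real (1 - 1 / h d x) * f x"
      using hpos[of d x] by (simp add: g_def field_simps)
    hence "norm (f x - g d x) = \<bar>1 - 1 / h d x\<bar> * norm (f x)" by (simp add: norm_mult del: of_real_diff)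
    also have "\<dots> = \<bar>norm (f x) - norm (f x) / h d x\<bar>"
      by (subst abs_mult[of _ "norm (f x)", simplified, symmetric]) (simp add: algebra_simps)
    also have "\<dots> \<le> d / 2 * norm (f x)^2"
      using cutoff_bounds(2)[OF that, of "norm (f x)"] by (simp add: h_def)
    finally show ?thesis .
  qed
  have g_conv: "(\<lambda>n. LINT x|M n. g d x) \<longlonglongrightarrow> (LINT x|M'. g d x)" if "d > 0" for d
  proof (rule weak_conv_imp_integral_bdd_continuous_conv[OF M(1,2,3) _ g_bdd[OF that]])
    show "isCont (g d) x" for x unfolding g_def using hpos[of d x]
      by (intro continuous_intros isCont conth) auto
  qed
  have q_conv: "(\<lambda>n. LINT x|M n. norm (f x)^2 / h d x) \<longlonglongrightarrow> (LINT x|M'. norm (f x)^2 / h d x)"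
    if "d > 0" for d
  proof (rule weak_conv_imp_integral_bdd_continuous_conv[OF M(1,2,3)])
    show "isCont (\<lambda>x. norm (f x)^2 / h d x) x" for x using hpos[of d x]
      by (intro continuous_intros isCont conth) auto
    show "norm (norm (f x)^2 / h d x) \<le> 1 / d^2" for x
      using cutoff_bounds(3)[OF that, of "norm (f x)"] hpos[of d x] by (simp add: h_def)
  qed
  have q_int: "integrable N (\<lambda>x. norm (f x)^2 / h d x)"
    if "d > 0" "finite_measure N" "sets N = sets borel" for d N
  proof -
    have [measurable_cong]: "sets N = sets borel" by fact
    show ?thesis
    proof (rule finite_measure.integrable_const_bound[OF that(2), where B = "1 / d^2"])
      show "AE x in N. norm (norm (f x)^2 / h d x) \<le> 1 / d^2"
        using cutoff_bounds(3)[OF that(1), of "norm (f x)" for x] hpos[of d]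
        by (simp add: h_def)
    qed measurable
  qed
  have q_le: "(LINT x|M'. norm (f x)^2 / h d x) \<le> C" if "d > 0" for d
  proof (rule LIMSEQ_le_const2[OF q_conv[OF that]], intro exI allI impI)
    fix n :: nat
    have "(LINT x|M n. norm (f x)^2 / h d x) \<le> (LINT x|M n. norm (f x)^2)"
      using cutoff_bounds(4)[OF that, of "norm (f x)" for x]
      by (intro integral_mono int q_int that) (auto simp: h_def M.finite_measure_axioms)
    with bound[of n] show "(LINT x|M n. norm (f x)^2 / h d x) \<le> C" by linarith
  qed
  have "(\<integral>\<^sup>+ x. ennreal (norm (f x)^2) \<partial>M') \<le> ennreal C"
  proof -
    define d where "d k = 1 / real (Suc k)" for k
    have dpos: "d k > 0" for k by (simp add: d_def)
    have d0: "d \<longlonglongrightarrow> 0" unfolding d_def using LIMSEQ_inverse_real_of_nat by (simp add: inverse_eq_divide)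
    have "liminf (\<lambda>k. ennreal (norm (f x)^2 / h (d k) x)) = ennreal (norm (f x)^2)" for x
    proof -
      have "(\<lambda>k. norm (f x)^2 / h (d k) x) \<longlonglongrightarrow> norm (f x)^2 / (1 + (0 * norm (f x))^2)"
        unfolding h_def by (intro tendsto_intros d0) auto
      thus ?thesis by (intro lim_imp_Liminf tendsto_ennrealI) auto
    qed
    hence "(\<integral>\<^sup>+ x. ennreal (norm (f x)^2) \<partial>M')
        = (\<integral>\<^sup>+ x. liminf (\<lambda>k. ennreal (norm (f x)^2 / h (d k) x)) \<partial>M')"
      by simp
    also have "\<dots> \<le> liminf (\<lambda>k. \<integral>\<^sup>+ x. ennreal (norm (f x)^2 / h (d k) x) \<partial>M')"
      by (rule nn_integral_liminf) measurable
    also have "\<dots> = liminf (\<lambda>k. ennreal (LINT x|M'. norm (f x)^2 / h (d k) x))"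
      using hpos[THEN less_imp_le]
      by (simp add: nn_integral_eq_integral q_int dpos M'.finite_measure_axioms)
    also have "\<dots> \<le> ennreal C"
      by (intro Liminf_le always_eventually allI ennreal_leI q_le dpos) simp
    finally show ?thesis .
  qed
  hence int2: "integrable M' (\<lambda>x. norm (f x)^2)"
    by (intro integrableI_nonneg) (auto simp: top_unique le_less_trans)
  have bound': "(LINT x|M'. norm (f x)^2) \<le> C"
  proof -
    have "ennreal (LINT x|M'. norm (f x)^2) \<le> ennreal C"
      using \<open>(\<integral>\<^sup>+ x. ennreal (norm (f x)^2) \<partial>M') \<le> ennreal C\<close> int2
      by (simp add: nn_integral_eq_integral)
    thus ?thesis using C0 by simp
  qed
  have f_int: "integrable N f"
    if "finite_measure N" "sets N = sets borel" "integrable N (\<lambda>x. norm (f x)^2)" for N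
  proof -
    have [measurable_cong]: "sets N = sets borel" by fact
    interpret N: finite_measure N by fact
    show ?thesis
    proof (rule Bochner_Integration.integrable_bound[where f = "\<lambda>x. 1 + norm (f x)^2"])
      have "y \<le> 1 + y^2" for y :: real using zero_le_power2[of "y - 1/2"]
        by (simp add: power2_eq_square algebra_simps)
      thus "AE x in N. norm (f x) \<le> norm (1 + norm (f x)^2)" by (auto intro: order.trans)
    qed (use that in auto)
  qed
  show intf: "integrable M' f"
    by (rule f_int[OF M'.finite_measure_axioms _ int2]) simp
  have approx: "norm ((LINT x|N. f x) - (LINT x|N. g d x)) \<le> d / 2 * C"
    if d: "d > 0" and "finite_measure N" "sets N = sets borel" "integrable N (\<lambda>x. norm (f x)^2)"
      "(LINT x|N. norm (f x)^2) \<le> C" for N d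
  proof -
    have [measurable_cong]: "sets N = sets borel" by fact
    interpret N: finite_measure N by fact
    have ig: "integrable N (g d)"
      by (rule N.integrable_const_bound[where B = "1 / (2 * d)"]) (use g_bdd[OF d] in auto)
    have if_: "integrable N f" by (rule f_int) fact+
    have "norm ((LINT x|N. f x) - (LINT x|N. g d x)) = norm (LINT x|N. f x - g d x)"
      using ig if_ by simp
    also have "\<dots> \<le> (LINT x|N. norm (f x - g d x))" by (rule integral_norm_bound)
    also have "\<dots> \<le> (LINT x|N. d / 2 * norm (f x)^2)"
      using ig if_ that g_diff[OF d] by (intro integral_mono) auto
    also have "\<dots> = d / 2 * (LINT x|N. norm (f x)^2)" by simp
    also have "\<dots> \<le> d / 2 * C" using that by (intro mult_left_mono) auto
    finally show ?thesis .
  qed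
  show "(\<lambda>n. LINT x|M n. f x) \<longlonglongrightarrow> (LINT x|M'. f x)"
  proof (rule tendstoI)
    fix e :: real assume e: "e > 0"
    define d where "d = e / (C + 1)"
    have d: "d > 0" using e C0 by (simp add: d_def)
    have dC: "d / 2 * C < e / 2" using e C0 by (simp add: d_def divide_simps)
    have "e - d * C > 0" using dC by simp
    from tendstoD[OF g_conv[OF d] this]
    show "\<forall>\<^sub>F n in sequentially. dist (LINT x|M n. f x) (LINT x|M'. f x) < e"
    proof eventually_elim
      case (elim n)
      have "norm ((LINT x|M n. f x) - (LINT x|M n. g d x)) \<le> d / 2 * C"
        by (rule approx[OF d M.finite_measure_axioms _ int bound]) simp
      moreover have "norm ((LINT x|M'. f x) - (LINT x|M'. g d x)) \<le> d / 2 * C"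
        by (rule approx[OF d M'.finite_measure_axioms _ int2 bound']) simp
      moreover have "norm (a - b) \<le> norm (a - a') + norm (a' - b') + norm (b - b')"
        for a b a' b' :: complex by norm
      note this[of "LINT x|M n. f x" "LINT x|M'. f x" "LINT x|M n. g d x" "LINT x|M'. g d x"]
      moreover have "d / 2 * C + d / 2 * C = d * C" by simp
      ultimately show ?case using elim unfolding dist_norm by linarith
    qed
  qed
qed

text \<open>
  The function r^k u^l on the strip, where u = exp (2 pi i y) is a point of the circle.
\<close>

definition strip_monomial :: "nat \<Rightarrow> int \<Rightarrow> real \<Rightarrow> real \<Rightarrow> complex" where
  "strip_monomial k l r y = complex_of_real (r ^ k) * cis (2 * pi * of_int l * y)"

lemma norm_strip_monomial: "norm (strip_monomial k l r y) = \<bar>r\<bar> ^ k"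
  by (simp add: strip_monomial_def norm_mult norm_power power_abs)

lemma continuous_on_strip_monomial:
  assumes "continuous_on A f" "continuous_on A g"
  shows "continuous_on A (\<lambda>x. strip_monomial k l (f x) (g x))"
  unfolding strip_monomial_def using assms by (intro continuous_intros) auto

text \<open>
  The atoms are pulled back along the space-filling curve and normalised to probability measures on
  the line. The convergent second moments give tightness, Helly's theorem a weak limit M, and the
  convergent moments of order 2 k the uniform second moment bound under which the moments of order k pass
  to M. Finally M is scaled to the mass G 0 0.
\<close>

lemma measure_of_convergent_atomic_moments:
  fixes X :: "nat \<Rightarrow> (real \<times> real) set" and w :: "nat \<Rightarrow> real \<times> real \<Rightarrow> real"
  assumes fin: "\<And>N. finite (X N)"
    and strip: "\<And>N x. x \<in> X N \<Longrightarrow> 0 \<le> snd x \<and> snd x \<le> 1"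
    and w: "\<And>N x. x \<in> X N \<Longrightarrow> 0 \<le> w N x"
    and mass: "\<And>N. 0 < sum (w N) (X N)"
    and lim: "\<And>k l. (\<lambda>N. \<Sum>x\<in>X N. w N x * strip_monomial k l (fst x) (snd x)) \<longlonglongrightarrow> G k l"
    and G0: "G 0 0 \<noteq> 0"
  obtains \<sigma> :: "real measure" and R Y :: "real \<Rightarrow> real"
  where "sets \<sigma> = sets borel" "R \<in> borel_measurable borel" "Y \<in> borel_measurable borel"
    and "\<And>k l. integrable \<sigma> (\<lambda>s. strip_monomial k l (R s) (Y s))"
    and "\<And>k l. (LINT s|\<sigma>. strip_monomial k l (R s) (Y s)) = G k l"
proof -
  obtain R Y :: "real \<Rightarrow> real" where contR: "continuous_on UNIV R" and contY: "continuous_on UNIV Y"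
    and curve: "\<And>r y. 0 \<le> y \<Longrightarrow> y \<le> 1 \<Longrightarrow> \<exists>s. R s = r \<and> Y s = y \<and> \<bar>s\<bar> \<le> 2 * \<bar>r\<bar> + 3"
    using space_filling_curve_strip by blast
  have [measurable]: "R \<in> borel_measurable borel" "Y \<in> borel_measurable borel"
    using contR contY by (auto intro: borel_measurable_continuous_onI)
  define par where "par x = (SOME s. R s = fst x \<and> Y s = snd x \<and> \<bar>s\<bar> \<le> 2 * \<bar>fst x\<bar> + 3)"
    for x :: "real \<times> real"
  have par: "R (par x) = fst x" "Y (par x) = snd x" "\<bar>par x\<bar> \<le> 2 * \<bar>fst x\<bar> + 3"
    if "x \<in> X N" for x N
    using someI_ex[OF curve[of "snd x" "fst x"]] strip[OF that] unfolding par_def by blast+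
  have contF: "continuous_on UNIV (\<lambda>s. strip_monomial k l (R s) (Y s))" for k l
    by (intro continuous_on_strip_monomial contR contY)
  have [measurable]: "(\<lambda>s. strip_monomial k l (R s) (Y s)) \<in> borel_measurable borel" for k l
    by (rule borel_measurable_continuous_onI[OF contF])
  define C where "C N = sum (w N) (X N)" for N
  have Cpos: "C N > 0" for N using mass by (simp add: C_def)
  define g where "g = Re (G 0 0)"
  have C_lim: "(\<lambda>N. complex_of_real (C N)) \<longlonglongrightarrow> G 0 0"
    using lim[of 0 0] by (simp add: strip_monomial_def C_def)
  have C_lim': "C \<longlonglongrightarrow> g" using tendsto_Re[OF C_lim] by (simp add: g_def)
  have "(\<lambda>N. complex_of_real (C N)) \<longlonglongrightarrow> of_real g" using C_lim' by (rule tendsto_of_real)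
  hence G00: "G 0 0 = of_real g" using C_lim LIMSEQ_unique by blast
  have gpos: "g > 0"
  proof -
    have "g \<ge> 0" using Cpos less_imp_le by (intro LIMSEQ_le_const[OF C_lim']) blast
    thus ?thesis using G0 G00 by (cases "g = 0") auto
  qed
  define prob where "prob N x = (if x \<in> X N then w N x / C N else 0)" for N x
  define p where "p N = embed_pmf (prob N)" for N
  have prob_nonneg: "0 \<le> prob N x" for N x using w Cpos[of N] by (simp add: prob_def)
  have pmf_p: "pmf (p N) x = prob N x" for N x unfolding p_def
  proof (rule pmf_embed_pmf[OF prob_nonneg])
    have "(\<integral>\<^sup>+ x. ennreal (prob N x) \<partial>count_space UNIV) = (\<Sum>x\<in>X N. ennreal (prob N x))"
      by (rule nn_integral_count_space') (auto simp: fin prob_def)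
    also have "\<dots> = ennreal (\<Sum>x\<in>X N. prob N x)" by (rule sum_ennreal) (rule prob_nonneg)
    also have "(\<Sum>x\<in>X N. prob N x) = (\<Sum>x\<in>X N. w N x) / C N"
      by (simp add: prob_def sum_divide_distrib)
    also have "\<dots> = 1" using Cpos[of N] by (simp add: C_def)
    finally show "(\<integral>\<^sup>+ x. ennreal (prob N x) \<partial>count_space UNIV) = 1" by simp
  qed
  have set_p: "set_pmf (p N) \<subseteq> X N" for N
    by (auto simp: set_pmf_iff pmf_p prob_def split: if_splits)
  have fin_p: "finite (set_pmf (p N))" for N using set_p fin finite_subset by blast
  define \<mu> where "\<mu> N = distr (measure_pmf (p N)) borel par" for N
  have \<mu>_dist: "real_distribution (\<mu> N)" for N
    unfolding \<mu>_def by (rule prob_space.real_distribution_distr[OF measure_pmf.prob_space_axioms]) simp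
  have \<mu>_integrable: "integrable (\<mu> N) h" if [measurable]: "h \<in> borel_measurable borel"
    for N and h :: "real \<Rightarrow> 'a::{banach, second_countable_topology}"
    unfolding \<mu>_def by (subst integrable_distr_eq) (auto intro: integrable_measure_pmf_finite fin_p)
  have \<mu>_integral: "(LINT s|\<mu> N. h s) = (\<Sum>x\<in>X N. (w N x / C N) *\<^sub>R h (par x))"
    if [measurable]: "h \<in> borel_measurable borel"
    for N and h :: "real \<Rightarrow> 'a::{banach, second_countable_topology}"
  proof -
    have "(LINT s|\<mu> N. h s) = (LINT x|measure_pmf (p N). h (par x))"
      unfolding \<mu>_def by (rule integral_distr) auto
    also have "\<dots> = (\<Sum>x\<in>X N. pmf (p N) x *\<^sub>R h (par x))"
      using set_p by (intro integral_measure_pmf fin) auto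
    also have "\<dots> = (\<Sum>x\<in>X N. (w N x / C N) *\<^sub>R h (par x))"
      by (intro sum.cong) (auto simp: pmf_p prob_def)
    finally show ?thesis .
  qed
  have \<mu>_moment: "(LINT s|\<mu> N. strip_monomial k l (R s) (Y s))
      = (\<Sum>x\<in>X N. w N x * strip_monomial k l (fst x) (snd x)) / of_real (C N)" for N k l
    by (subst \<mu>_integral) (auto simp: par scaleR_conv_of_real sum_divide_distrib intro!: sum.cong)
  have \<mu>_moment_lim: "(\<lambda>N. LINT s|\<mu> N. strip_monomial k l (R s) (Y s)) \<longlonglongrightarrow> G k l / of_real g" for k l
    unfolding \<mu>_moment using gpos by (intro tendsto_divide lim tendsto_of_real C_lim') auto
  have even_moment: "(LINT s|\<mu> N. R s ^ (2 * k)) = Re (LINT s|\<mu> N. strip_monomial (2 * k) 0 (R s) (Y s))" for N k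
    by (subst integral_Re[symmetric]) (auto simp: \<mu>_integrable strip_monomial_def)
  have "\<exists>B. \<forall>N. (LINT s|\<mu> N. R s ^ (2 * k)) \<le> B" for k
  proof -
    have "Bseq (\<lambda>N. LINT s|\<mu> N. strip_monomial (2 * k) 0 (R s) (Y s))"
      using \<mu>_moment_lim by (rule convergent_imp_Bseq[OF convergentI])
    then obtain B where "\<And>N. norm (LINT s|\<mu> N. strip_monomial (2 * k) 0 (R s) (Y s)) \<le> B"
      by (auto simp: Bseq_def)
    thus ?thesis unfolding even_moment by (meson complex_Re_le_cmod order.trans)
  qed
  then obtain B where B: "\<And>N k. (LINT s|\<mu> N. R s ^ (2 * k)) \<le> B k" by metis
  have second: "(LINT s|\<mu> N. s^2) \<le> 8 * B 1 + 18" for N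
  proof -
    have "(LINT s|\<mu> N. s^2) = (\<Sum>x\<in>X N. (w N x / C N) * (par x)^2)"
      by (subst \<mu>_integral) auto
    also have "\<dots> \<le> (\<Sum>x\<in>X N. (w N x / C N) * (8 * (R (par x))^2 + 18))"
    proof (intro sum_mono mult_left_mono)
      fix x assume x: "x \<in> X N"
      \<comment> \<open>The curve reaches r at a parameter of size at most 2 |r| + 3, and 4 r^2 + 12 |r| + 9 is at most
         8 r^2 + 18 because (2 |r| - 3)^2 is nonnegative.\<close>
      have "(par x)^2 \<le> (2 * \<bar>fst x\<bar> + 3)^2"
        using par(3)[OF x] by (metis abs_le_square_iff abs_of_nonneg abs_ge_zero order.trans)
      also have "\<dots> \<le> 8 * (fst x)^2 + 18"
        using zero_le_power2[of "2 * \<bar>fst x\<bar> - 3"] by (simp add: power2_sum power2_diff power_mult_distrib)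
      finally show "(par x)^2 \<le> 8 * (R (par x))^2 + 18" using par[OF x] by simp
      show "0 \<le> w N x / C N" using w[OF x] Cpos[of N] by simp
    qed
    also have "\<dots> = (LINT s|\<mu> N. 8 * (R s)^2 + 18)" by (subst \<mu>_integral) auto
    also have "\<dots> = 8 * (LINT s|\<mu> N. (R s)^2) + 18"
    proof -
      interpret real_distribution "\<mu> N" by (rule \<mu>_dist)
      show ?thesis using prob_space by (subst Bochner_Integration.integral_add) (auto simp: \<mu>_integrable)
    qed
    also have "\<dots> \<le> 8 * B 1 + 18" using B[of N 1] by simp
    finally show ?thesis .
  qed
  have "tight \<mu>" unfolding tight_def
  proof (intro conjI allI impI)
    show "real_distribution (\<mu> N)" for N by (rule \<mu>_dist)
    fix \<epsilon> :: real assume \<epsilon>: "\<epsilon> > 0"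
    define A where "A = sqrt ((\<bar>8 * B 1 + 18\<bar> + 1) / \<epsilon>)"
    have A: "A > 0" "A^2 = (\<bar>8 * B 1 + 18\<bar> + 1) / \<epsilon>" using \<epsilon> by (auto simp: A_def)
    have "\<epsilon> * A^2 = \<bar>8 * B 1 + 18\<bar> + 1" using A(2) \<epsilon> by simp
    hence \<epsilon>A: "8 * B 1 + 18 < \<epsilon> * A^2" by linarith
    have "measure (\<mu> N) {-A<..A} > 1 - \<epsilon>" for N
    proof -
      interpret real_distribution "\<mu> N" by (rule \<mu>_dist)
      have "measure (\<mu> N) {s \<in> space (\<mu> N). s^2 \<ge> A^2} \<le> (LINT s|\<mu> N. s^2) / A^2"
        by (rule integral_Markov_inequality_measure[of _ _ UNIV]) (use zero_less_power[OF A(1), of 2] in \<open>auto simp: \<mu>_integrable\<close>)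
      also have "\<dots> \<le> (8 * B 1 + 18) / A^2" using second[of N] by (intro divide_right_mono) auto
      also have "\<dots> < \<epsilon>" using A(1) \<epsilon>A by (simp add: divide_less_eq)
      finally have small: "measure (\<mu> N) {s. s^2 \<ge> A^2} < \<epsilon>" by simp
      have "1 - measure (\<mu> N) {-A<..A} = measure (\<mu> N) (space (\<mu> N) - {-A<..A})"
        by (subst prob_compl) auto
      also have "\<dots> \<le> measure (\<mu> N) {s. s^2 \<ge> A^2}"
      proof (rule finite_measure_mono)
        have "A^2 \<le> s^2" if "s \<notin> {-A<..A}" for s
          using that A(1) by (intro abs_le_square_iff[THEN iffD1]) auto
        thus "space (\<mu> N) - {-A<..A} \<subseteq> {s. s^2 \<ge> A^2}" by auto
      qed simp
      finally show ?thesis using small by linarith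
    qed
    thus "\<exists>a b. a < b \<and> (\<forall>N. 1 - \<epsilon> < measure (\<mu> N) {a<..b})"
      using A(1) by (intro exI[of _ "-A"] exI[of _ A]) auto
  qed
  from tight_imp_convergent_subsubsequence[OF this strict_mono_id]
  obtain sub M where sub: "strict_mono sub" "real_distribution M" "weak_conv_m (\<mu> \<circ> sub) M"
    by (auto simp: o_def)
  have moments: "integrable M (\<lambda>s. strip_monomial k l (R s) (Y s))"
    "(LINT s|M. strip_monomial k l (R s) (Y s)) = G k l / of_real g" for k l
  proof -
    have n2: "norm (strip_monomial k l (R s) (Y s))^2 = R s ^ (2 * k)" for s
      by (simp add: norm_strip_monomial power_mult power2_eq_square flip: power_mult_distrib)
    note conv = weak_conv_integral_of_bounded_second_moments[OF _ sub(2,3) contF[of k l], of "B k",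
        unfolded o_def n2]
    show "integrable M (\<lambda>s. strip_monomial k l (R s) (Y s))"
      by (rule conv(1)) (auto simp: \<mu>_dist \<mu>_integrable B)
    have "(\<lambda>n. LINT s|\<mu> (sub n). strip_monomial k l (R s) (Y s))
        \<longlonglongrightarrow> (LINT s|M. strip_monomial k l (R s) (Y s))"
      by (rule conv(2)) (auto simp: \<mu>_dist \<mu>_integrable B)
    moreover have "(\<lambda>n. LINT s|\<mu> (sub n). strip_monomial k l (R s) (Y s)) \<longlonglongrightarrow> G k l / of_real g"
      using LIMSEQ_subseq_LIMSEQ[OF \<mu>_moment_lim sub(1)] by (simp add: o_def)
    ultimately show "(LINT s|M. strip_monomial k l (R s) (Y s)) = G k l / of_real g"
      using LIMSEQ_unique by blast
  qed
  have [measurable_cong]: "sets M = sets borel"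
    using sub(2) by (simp add: real_distribution_def real_distribution_axioms_def)
  show ?thesis
  proof (rule that)
    show "sets (density M (\<lambda>_. ennreal g)) = sets borel" by simp fact
    show "integrable (density M (\<lambda>_. ennreal g)) (\<lambda>s. strip_monomial k l (R s) (Y s))" for k l
      using gpos moments(1) by (subst integrable_density) auto
    show "(LINT s|density M (\<lambda>_. ennreal g). strip_monomial k l (R s) (Y s)) = G k l" for k l
      using gpos moments by (subst integral_density) (auto simp: scaleR_conv_of_real)
  qed measurable
qed

section \<open>Positive definite functions in polar form\<close>

text \<open>
  Positive definiteness on the semigroup of the pairs (k, l), k natural and l an integer, with the involution
  (k, l)* = (k, - l); the characters of the strip are the functions r^k u^l.
\<close>

definition strip_positive_definite :: "(nat \<Rightarrow> int \<Rightarrow> complex) \<Rightarrow> bool" where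
  "strip_positive_definite G \<longleftrightarrow> (\<forall>F c. finite F \<longrightarrow>
     (\<Sum>(j, a)\<in>F. \<Sum>(k, b)\<in>F. c (j, a) * cnj (c (k, b)) * G (j + k) (a - b)) \<in> \<real>\<^sub>\<ge>\<^sub>0)"

lemma strip_positive_definiteD:
  assumes "strip_positive_definite G" "finite F"
  shows "(\<Sum>(j, a)\<in>F. \<Sum>(k, b)\<in>F. c (j, a) * cnj (c (k, b)) * G (j + k) (a - b)) \<in> \<real>\<^sub>\<ge>\<^sub>0"
  using assms unfolding strip_positive_definite_def by blast

lemma strip_positive_definite_diag:
  assumes "strip_positive_definite G"
  shows "G (2 * k) 0 \<in> \<real>\<^sub>\<ge>\<^sub>0"
  using strip_positive_definiteD[OF assms, of "{(k, 0)}" "\<lambda>_. 1"] by (simp add: mult_2)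

lemma strip_positive_definite_pair:
  assumes "strip_positive_definite G" "(k, l) \<noteq> (0, 0)"
  shows "G 0 0 + cnj c * G k (- l) + c * G k l + c * cnj c * G (2 * k) 0 \<in> \<real>\<^sub>\<ge>\<^sub>0"
proof -
  define g where "g = G (2 * k) 0"
  have [simp]: "G (k + k) 0 = g" by (simp add: g_def mult_2)
  show ?thesis
    using strip_positive_definiteD[OF assms(1), of "{(0, 0), (k, l)}" "\<lambda>x. if x = (0, 0) then 1 else c"]
      assms(2) unfolding g_def[symmetric]
    by (auto simp: algebra_simps split: if_splits)
qed

lemma strip_positive_definite_hermitian:
  assumes "strip_positive_definite G"
  shows "G k (- l) = cnj (G k l)"
proof (cases "(k, l) = (0, 0)")
  case True
  thus ?thesis using strip_positive_definite_diag[OF assms, of 0]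
    by (auto simp: complex_eq_iff complex_nonneg_Reals_iff)
next
  case False
  note P = strip_positive_definite_pair[OF assms False]
  have "Im (G 0 0) = 0" "Im (G (2 * k) 0) = 0"
    using strip_positive_definite_diag[OF assms, of 0] strip_positive_definite_diag[OF assms, of k]
    by (auto simp: complex_nonneg_Reals_iff)
  with P[of 1] P[of \<i>] show ?thesis
    by (auto simp: complex_eq_iff complex_nonneg_Reals_iff)
qed

text \<open>
  The principal minor belonging to (0, 0) and (k, l), tested at the vector (1, c) with |c| = t and c
  rotated so that c G k l is negative. At t = 1 the bound is uniform in l, and for small t it
  shows that G vanishes once its total mass does.
\<close>

lemma strip_positive_definite_bound:
  assumes PD: "strip_positive_definite G" and t: "t > 0"
  shows "2 * t * norm (G k l) \<le> Re (G 0 0) + t^2 * Re (G (2 * k) 0)"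
proof -
  have nn: "Re (G 0 0) \<ge> 0" "Im (G 0 0) = 0" "Re (G (2 * k) 0) \<ge> 0"
    using strip_positive_definite_diag[OF PD, of 0] strip_positive_definite_diag[OF PD, of k]
    by (auto simp: complex_nonneg_Reals_iff)
  consider "(k, l) = (0, 0)" | "G k l = 0" | "(k, l) \<noteq> (0, 0)" "G k l \<noteq> 0" by blast
  thus ?thesis
  proof cases
    case 1
    have "norm (G 0 0) = Re (G 0 0)" using nn by (simp add: cmod_eq_Re)
    moreover have "2 * t * Re (G 0 0) \<le> (1 + t^2) * Re (G 0 0)"
      using zero_le_power2[of "1 - t"] nn by (intro mult_right_mono) (auto simp: power2_diff)
    ultimately show ?thesis using 1 by (simp add: algebra_simps)
  next
    case 2
    thus ?thesis using nn by simp
  next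
    case 3
    define z where "z = G k l"
    define c where "c = - complex_of_real t * cnj (sgn z)"
    have z0: "z \<noteq> 0" using 3 by (simp add: z_def)
    have u: "cnj (sgn z) * z = of_real (norm z)"
      using z0 by (simp add: sgn_div_norm scaleR_conv_of_real field_simps complex_norm_square[symmetric] power2_eq_square)
    have cz: "c * z = of_real (- t * norm z)" unfolding c_def using u by (simp add: mult.assoc)
    have cc: "c * cnj c = of_real (t^2)"
    proof -
      have "norm c = t" using t z0 by (simp add: c_def norm_mult norm_sgn)
      thus ?thesis using complex_norm_square[of c] by simp
    qed
    have "G 0 0 + cnj (c * z) + c * z + c * cnj c * G (2 * k) 0 \<in> \<real>\<^sub>\<ge>\<^sub>0"
      using strip_positive_definite_pair[OF PD 3(1), of c]
      by (simp add: z_def strip_positive_definite_hermitian[OF PD])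
    hence "0 \<le> Re (G 0 0 + cnj (of_real (- t * norm z)) + of_real (- t * norm z) + of_real (t^2) * G (2 * k) 0)"
      unfolding cz cc by (simp only: complex_nonneg_Reals_iff)
    thus ?thesis by (simp add: z_def)
  qed
qed

lemma strip_positive_definite_eq_0:
  assumes PD: "strip_positive_definite G" and "G 0 0 = 0"
  shows "G k l = 0"
proof (rule ccontr)
  assume nz: "G k l \<noteq> 0"
  define g where "g = Re (G (2 * k) 0)"
  have g: "g \<ge> 0" using strip_positive_definite_diag[OF PD, of k] by (simp add: g_def complex_nonneg_Reals_iff)
  define t where "t = norm (G k l) / (g + 1)"
  have t: "t > 0" using nz g by (simp add: t_def add_nonneg_pos)
  have "2 * t * norm (G k l) \<le> t^2 * g"
    using strip_positive_definite_bound[OF PD t, of k l] assms(2) by (simp add: g_def)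
  hence "t * (2 * norm (G k l)) \<le> t * (t * g)" by (simp add: power2_eq_square mult_ac)
  hence "2 * norm (G k l) \<le> t * g" using t by simp
  also have "\<dots> \<le> t * (g + 1)" using t by simp
  also have "\<dots> = norm (G k l)" using g by (simp add: t_def)
  finally show False using nz by simp
qed

lemma sum_roots_of_unity:
  fixes N :: nat and d :: int
  assumes "N > 0"
  shows "(\<Sum>j<N. cis (2 * pi * of_int d * (real j / real N))) = (if int N dvd d then of_nat N else 0)"
proof -
  define z where "z = cis (2 * pi * of_int d / real N)"
  have zj: "cis (2 * pi * of_int d * (real j / real N)) = z ^ j" for j
    unfolding z_def Complex.DeMoivre by (rule arg_cong[of _ _ cis]) simp
  have zN: "z ^ N = 1"
    using assms cis_multiple_2pi[of "of_int d"] by (simp add: z_def Complex.DeMoivre)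
  show ?thesis
  proof (cases "int N dvd d")
    case True
    then obtain e where e: "d = int N * e" by blast
    have "z = cis (2 * pi * of_int e)" unfolding z_def e
      using assms by (intro arg_cong[of _ _ cis]) simp
    hence "z = 1" using cis_multiple_2pi[OF Ints_of_int, of e] by (rule trans)
    thus ?thesis unfolding zj using True by simp
  next
    case False
    have "z \<noteq> 1"
    proof
      assume "z = 1"
      hence "cos (2 * pi * of_int d / real N) = 1" by (simp add: z_def complex_eq_iff)
      then obtain n :: int where "2 * pi * of_int d / real N = of_int n * 2 * pi"
        by (auto simp: cos_one_2pi_int)
      hence "of_int d = real N * of_int n" using assms by (simp add: field_simps)
      hence "d = int N * n" by (metis of_int_eq_iff of_int_mult of_int_of_nat_eq)
      with False show False by simp
    qed
    hence "(\<Sum>j<N. z ^ j) = 0" using zN geometric_sum[of z N] by simp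
    thus ?thesis unfolding zj using False by simp
  qed
qed

text \<open>
  The k-th moment of a candidate for the conditional distribution of r at the angle 2 pi y, up to a factor:
  averaging over the square of pairs (a, b), in place of cutting off the Fourier series, is what preserves
  positivity.
\<close>

definition fejer_moment :: "(nat \<Rightarrow> int \<Rightarrow> complex) \<Rightarrow> nat \<Rightarrow> real \<Rightarrow> nat \<Rightarrow> complex" where
  "fejer_moment G N y k =
     (\<Sum>a\<in>{0..<int N}. \<Sum>b\<in>{0..<int N}. G k (a - b) * cis (2 * pi * of_int (b - a) * y)) / of_nat N ^ 2"

lemma fejer_moment_real:
  assumes "strip_positive_definite G"
  shows "complex_of_real (Re (fejer_moment G N y k)) = fejer_moment G N y k"
proof -
  have "cnj (fejer_moment G N y k) =
    (\<Sum>a\<in>{0..<int N}. \<Sum>b\<in>{0..<int N}. G k (b - a) * cis (2 * pi * of_int (a - b) * y)) / of_nat N ^ 2"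
  proof -
    have "cnj (G k (a - b) * cis (2 * pi * of_int (b - a) * y)) = G k (b - a) * cis (2 * pi * of_int (a - b) * y)"
      for a b
      using strip_positive_definite_hermitian[OF assms, of k "a - b"] by (simp add: cis_cnj algebra_simps)
    thus ?thesis by (simp add: fejer_moment_def del: complex_cnj_mult)
  qed
  also have "\<dots> = fejer_moment G N y k" unfolding fejer_moment_def by (subst sum.swap) simp
  finally show ?thesis by (simp add: complex_eq_iff)
qed

text \<open>
  Summing over the grid of angles undoes the Fejer mean up to aliasing: only those frequencies a - b
  survive that are congruent to l modulo N, and for each b there is exactly one.
\<close>

lemma sum_fejer_moment:
  fixes N :: nat
  assumes N: "N > 0"
  shows "(\<Sum>j<N. cis (2 * pi * of_int l * (real j / real N)) * fejer_moment G N (real j / real N) k)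
       = (\<Sum>b\<in>{0..<int N}. G k ((b + l) mod int N - b)) / of_nat N"
proof -
  have cis3: "cis (2 * pi * of_int l * t) * (g * cis (2 * pi * of_int (b - a) * t))
      = g * cis (2 * pi * of_int (l + b - a) * t)" for a b t g
    by (simp add: mult.left_commute[of _ g] cis_mult) (simp add: algebra_simps)
  have "cis (2 * pi * of_int l * t) * fejer_moment G N t k
     = (\<Sum>a\<in>{0..<int N}. \<Sum>b\<in>{0..<int N}.
         G k (a - b) * cis (2 * pi * of_int (l + b - a) * t)) / of_nat N ^ 2" for t
    unfolding fejer_moment_def times_divide_eq_right sum_distrib_left cis3 ..
  hence "(\<Sum>j<N. cis (2 * pi * of_int l * (real j / real N)) * fejer_moment G N (real j / real N) k)
     = (\<Sum>j<N. \<Sum>a\<in>{0..<int N}. \<Sum>b\<in>{0..<int N}.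
         G k (a - b) * cis (2 * pi * of_int (l + b - a) * (real j / real N))) / of_nat N ^ 2"
    by (simp only: sum_divide_distrib)
  also have "(\<Sum>j<N. \<Sum>a\<in>{0..<int N}. \<Sum>b\<in>{0..<int N}.
         G k (a - b) * cis (2 * pi * of_int (l + b - a) * (real j / real N)))
     = (\<Sum>b\<in>{0..<int N}. \<Sum>a\<in>{0..<int N}. \<Sum>j<N.
         G k (a - b) * cis (2 * pi * of_int (l + b - a) * (real j / real N)))"
    by (subst sum.swap, subst sum.swap, rule sum.cong[OF refl], rule sum.swap)
  also have "\<dots> = (\<Sum>b\<in>{0..<int N}. \<Sum>a\<in>{0..<int N}.
         if a = (b + l) mod int N then of_nat N * G k (a - b) else 0)"
  proof (intro sum.cong refl)
    fix a b assume a: "a \<in> {0..<int N}"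
    have "(\<Sum>j<N. G k (a - b) * cis (2 * pi * of_int (l + b - a) * (real j / real N)))
        = G k (a - b) * (if int N dvd l + b - a then of_nat N else 0)"
      unfolding sum_distrib_left[symmetric] by (subst sum_roots_of_unity[OF N]) simp
    moreover have "int N dvd l + b - a \<longleftrightarrow> a = (b + l) mod int N"
      using a by (auto simp: mod_eq_dvd_iff[symmetric] add.commute)
    ultimately show "(\<Sum>j<N. G k (a - b) * cis (2 * pi * of_int (l + b - a) * (real j / real N)))
      = (if a = (b + l) mod int N then of_nat N * G k (a - b) else 0)" by simp
  qed
  also have "\<dots> = (\<Sum>b\<in>{0..<int N}. of_nat N * G k ((b + l) mod int N - b))"
    using N by (intro sum.cong refl) (simp add: sum.delta)
  also have "\<dots> / of_nat N ^ 2 = (\<Sum>b\<in>{0..<int N}. G k ((b + l) mod int N - b)) / of_nat N"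
    using N by (simp add: power2_eq_square sum_distrib_left[symmetric])
  finally show ?thesis .
qed

text \<open>
  The aliased frequency differs from l only if b + l leaves the range from 0 to N - 1, which happens for
  at most |l| values of b.
\<close>

lemma sum_fejer_moment_error:
  fixes N :: nat
  assumes N: "N > 0" and B: "\<And>l. norm (G k l) \<le> B"
  shows "norm ((\<Sum>j<N. cis (2 * pi * of_int l * (real j / real N)) * fejer_moment G N (real j / real N) k) - G k l)
     \<le> 2 * B * \<bar>real_of_int l\<bar> / real N"
proof -
  have B0: "B \<ge> 0" using B[of 0] norm_ge_zero order.trans by blast
  define S where "S = {0..<- l} \<union> {int N - l..<int N}"
  have "card S \<le> card {0..<- l} + card {int N - l..<int N}" unfolding S_def by (rule card_Un_le)
  hence cardS: "real (card S) \<le> \<bar>real_of_int l\<bar>" by simp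
  define D where "D b = G k ((b + l) mod int N - b) - G k l" for b
  have "(\<Sum>j<N. cis (2 * pi * of_int l * (real j / real N)) * fejer_moment G N (real j / real N) k) - G k l
      = (\<Sum>b\<in>{0..<int N}. D b) / of_nat N"
    unfolding sum_fejer_moment[OF N] D_def sum_subtractf using N by (simp add: field_simps)
  also have "norm \<dots> \<le> (\<Sum>b\<in>{0..<int N}. norm (D b)) / real N"
    using N norm_sum[of D] by (simp add: norm_divide divide_right_mono)
  also have "(\<Sum>b\<in>{0..<int N}. norm (D b)) \<le> (\<Sum>b\<in>S. 2 * B)"
  proof -
    have "(\<Sum>b\<in>{0..<int N}. norm (D b)) = (\<Sum>b\<in>{0..<int N} \<inter> S. norm (D b))"
    proof (rule sum.mono_neutral_right)
      show "\<forall>b\<in>{0..<int N} - {0..<int N} \<inter> S. norm (D b) = 0"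
      proof
        fix b assume "b \<in> {0..<int N} - {0..<int N} \<inter> S"
        hence "0 \<le> b + l" "b + l < int N" by (auto simp: S_def)
        thus "norm (D b) = 0" by (simp add: D_def)
      qed
    qed auto
    also have "\<dots> \<le> (\<Sum>b\<in>{0..<int N} \<inter> S. 2 * B)"
    proof (rule sum_mono)
      fix b
      show "norm (D b) \<le> 2 * B"
        unfolding D_def using norm_triangle_ineq4[of "G k ((b + l) mod int N - b)" "G k l"]
          B[of "(b + l) mod int N - b"] B[of l] by linarith
    qed
    also have "\<dots> \<le> (\<Sum>b\<in>S. 2 * B)" using B0 by (intro sum_mono2) (auto simp: S_def)
    finally show ?thesis .
  qed
  also have "(\<Sum>b\<in>S. 2 * B) \<le> 2 * B * \<bar>real_of_int l\<bar>"
    using cardS B0 by (simp add: mult.commute mult_left_mono)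
  finally show ?thesis using N by (simp add: divide_right_mono)
qed

definition moment_functional :: "(nat \<Rightarrow> real) \<Rightarrow> real poly \<Rightarrow> real" where
  "moment_functional h q = (\<Sum>k\<le>degree q. coeff q k * h k)"

lemma moment_functional_eq: "degree q \<le> n \<Longrightarrow> moment_functional h q = (\<Sum>k\<le>n. coeff q k * h k)"
  unfolding moment_functional_def by (intro sum.mono_neutral_left) (auto simp: coeff_eq_0)

lemma linear_moment_functional: "linear_functional_poly (moment_functional h)"
proof
  fix p q :: "real poly" and c :: real
  define n where "n = max (degree p) (degree q)"
  have "degree p \<le> n" "degree q \<le> n" "degree (p + q) \<le> n"
    using degree_add_le_max[of p q] by (auto simp: n_def)
  thus "moment_functional h (p + q) = moment_functional h p + moment_functional h q"
    by (simp add: moment_functional_eq[of _ n] sum.distrib distrib_right)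
  show "moment_functional h (smult c p) = c * moment_functional h p"
    using degree_smult_le[of c p]
    by (simp add: moment_functional_eq[of _ "degree p"] sum_distrib_left mult_ac)
qed

lemma moment_functional_monom: "moment_functional h (monom c n) = c * h n"
  by (subst moment_functional_eq[OF degree_monom_le]) (simp add: if_distrib[of "\<lambda>x. x * _"] cong: if_cong)

lemma moment_functional_square:
  "moment_functional h (p * p) = (\<Sum>i\<le>degree p. \<Sum>j\<le>degree p. coeff p i * coeff p j * h (i + j))"
proof -
  interpret linear_functional_poly "moment_functional h" by (rule linear_moment_functional)
  have "p * p = (\<Sum>i\<le>degree p. monom (coeff p i) i) * (\<Sum>j\<le>degree p. monom (coeff p j) j)"
    by (simp add: poly_as_sum_of_monoms)
  also have "\<dots> = (\<Sum>i\<le>degree p. \<Sum>j\<le>degree p. monom (coeff p i * coeff p j) (i + j))"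
    by (simp add: sum_product mult_monom)
  finally have "moment_functional h (p * p)
      = moment_functional h (\<Sum>i\<le>degree p. \<Sum>j\<le>degree p. monom (coeff p i * coeff p j) (i + j))"
    by (rule arg_cong)
  thus ?thesis by (simp add: L_sum moment_functional_monom)
qed

text \<open>
  The Hankel form of the Fejer moments at p is the positive definite form of G at the
  coefficients coeff p i * exp (- 2 pi i a y), divided by N^2.
\<close>

lemma fejer_moment_square_nonneg:
  fixes p :: "real poly"
  assumes PD: "strip_positive_definite G"
  shows "0 \<le> (\<Sum>i\<le>degree p. \<Sum>j\<le>degree p. coeff p i * coeff p j * Re (fejer_moment G N y (i + j)))"
proof -
  define I where "I = {0..<int N}"
  define c where "c = (\<lambda>(i, a::int). complex_of_real (coeff p i) * cis (- (2 * pi * of_int a * y)))"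
  define P where "P = (\<Sum>(i, a)\<in>{..degree p} \<times> I. \<Sum>(j, b)\<in>{..degree p} \<times> I.
                        c (i, a) * cnj (c (j, b)) * G (i + j) (a - b))"
  have "P \<in> \<real>\<^sub>\<ge>\<^sub>0" unfolding P_def
    by (rule strip_positive_definiteD[OF PD]) (auto simp: I_def)
  hence P0: "0 \<le> Re P" by (simp add: complex_nonneg_Reals_iff)
  have summand: "c (i, a) * cnj (c (j, b)) * G (i + j) (a - b)
      = complex_of_real (coeff p i * coeff p j) * (G (i + j) (a - b) * cis (2 * pi * of_int (b - a) * y))"
    for i j a b
  proof -
    have "cis (- (2 * pi * of_int a * y)) * cis (2 * pi * of_int b * y) = cis (2 * pi * of_int (b - a) * y)"
      by (simp add: cis_mult) (simp add: algebra_simps)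
    thus ?thesis by (simp add: c_def cis_cnj mult_ac)
  qed
  have "P = (\<Sum>i\<le>degree p. \<Sum>a\<in>I. \<Sum>j\<le>degree p. \<Sum>b\<in>I. c (i, a) * cnj (c (j, b)) * G (i + j) (a - b))"
    unfolding P_def by (simp add: sum.cartesian_product[symmetric])
  also have "\<dots> = (\<Sum>i\<le>degree p. \<Sum>j\<le>degree p. \<Sum>a\<in>I. \<Sum>b\<in>I. c (i, a) * cnj (c (j, b)) * G (i + j) (a - b))"
    by (intro sum.cong refl sum.swap)
  also have "\<dots> = (\<Sum>i\<le>degree p. \<Sum>j\<le>degree p. complex_of_real (coeff p i * coeff p j) *
                (\<Sum>a\<in>I. \<Sum>b\<in>I. G (i + j) (a - b) * cis (2 * pi * of_int (b - a) * y)))"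
    unfolding summand sum_distrib_left ..
  finally have P: "P = (\<Sum>i\<le>degree p. \<Sum>j\<le>degree p. complex_of_real (coeff p i * coeff p j) *
                (\<Sum>a\<in>I. \<Sum>b\<in>I. G (i + j) (a - b) * cis (2 * pi * of_int (b - a) * y)))" .
  have "P / of_nat N ^ 2 = (\<Sum>i\<le>degree p. \<Sum>j\<le>degree p.
      complex_of_real (coeff p i * coeff p j) * fejer_moment G N y (i + j))"
    unfolding fejer_moment_def times_divide_eq_right I_def[symmetric] sum_divide_distrib[symmetric]
    by (rule arg_cong[OF P])
  hence "Re (P / of_nat N ^ 2) = (\<Sum>i\<le>degree p. \<Sum>j\<le>degree p.
      coeff p i * coeff p j * Re (fejer_moment G N y (i + j)))"
    by (simp del: of_real_mult)
  moreover have "Re (P / of_nat N ^ 2) = Re P / real N ^ 2"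
    using Re_divide_of_real[of P "real N ^ 2"] by simp
  ultimately show ?thesis using P0 by (metis divide_nonneg_nonneg zero_le_power2)
qed

text \<open>
  Gauss quadrature needs a functional that is strictly positive on squares of degree below 2 N. The sum over N
  distinct points is, because a nonzero polynomial of degree below N cannot vanish at all of them; the points
  are taken in the unit interval so that this perturbation has moments of order 1 / N^2 for each of the
  N angles.
\<close>

lemma fejer_quadrature:
  assumes PD: "strip_positive_definite G" and N: "N > 0"
  shows "\<exists>T w. finite T \<and> (\<forall>t\<in>T. w t \<ge> 0) \<and> 0 < sum w T \<and>
    (\<forall>k<2 * N. (\<Sum>t\<in>T. w t * t ^ k) = Re (fejer_moment G N y k) + (\<Sum>i<N. (real i / real N) ^ k) / real N ^ 3)"
proof -
  define M where "M = moment_functional (\<lambda>k. Re (fejer_moment G N y k))"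
  define E where "E q = (\<Sum>i<N. poly q (real i / real N)) / real N ^ 3" for q
  define L where "L q = M q + E q" for q
  interpret M: linear_functional_poly M unfolding M_def by (rule linear_moment_functional)
  interpret L: linear_functional_poly L
  proof
    show "L (p + q) = L p + L q" for p q
      by (simp add: L_def M.L_add E_def sum.distrib add_divide_distrib)
    show "L (smult c p) = c * L p" for c p
      by (simp add: L_def M.L_smult E_def sum_distrib_left[symmetric] distrib_left)
  qed
  have pos: "L (p * p) > 0" if p: "p \<noteq> 0" "degree p < N" for p
  proof -
    have "M (p * p) \<ge> 0"
      unfolding M_def moment_functional_square by (rule fejer_moment_square_nonneg[OF PD])
    moreover have "E (p * p) > 0"
    proof -
      have "\<exists>i<N. poly p (real i / real N) \<noteq> 0"
      proof (rule ccontr)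
        assume "\<not> ?thesis"
        hence "p = 0" using p(2) N
          by (intro poly_eqI_degree[of "(\<lambda>i. real i / real N) ` {..<N}"])
             (auto simp: card_image inj_on_def)
        with p(1) show False by simp
      qed
      then obtain i where i: "i < N" "poly p (real i / real N) \<noteq> 0" by blast
      have "0 < (\<Sum>i<N. poly (p * p) (real i / real N))"
        using i by (intro sum_pos2[of _ i]) (auto simp: zero_less_mult_iff)
      thus ?thesis using N by (simp add: E_def)
    qed
    ultimately show ?thesis by (simp add: L_def)
  qed
  obtain T w where T: "finite T" "\<forall>t\<in>T. w t \<ge> 0"
    and quad: "\<And>q. degree q < 2 * N \<Longrightarrow> L q = (\<Sum>t\<in>T. w t * poly q t)"
    using L.Gauss_quadrature[of N, OF pos] by blast
  have "0 < L (1 * 1)" using N by (intro pos) auto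
  hence "0 < sum w T" using quad[of 1] N by simp
  moreover have "(\<Sum>t\<in>T. w t * t ^ k)
      = Re (fejer_moment G N y k) + (\<Sum>i<N. (real i / real N) ^ k) / real N ^ 3" if k: "k < 2 * N" for k
  proof -
    have "(\<Sum>t\<in>T. w t * poly (monom 1 k) t) = L (monom 1 k)"
      using k by (intro quad[symmetric]) (auto simp: degree_monom_eq)
    also have "\<dots> = Re (fejer_moment G N y k) + (\<Sum>i<N. (real i / real N) ^ k) / real N ^ 3"
      by (simp add: L_def M_def E_def moment_functional_monom poly_monom)
    finally show ?thesis by (simp add: poly_monom)
  qed
  ultimately show ?thesis using T by blast
qed

text \<open>
  The union over the N angles of the quadrature measures. The first error term is aliasing, the second the
  perturbation that made the functionals strictly positive.
\<close>

lemma atomic_approximation: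
  assumes PD: "strip_positive_definite G" and N: "N > 0"
    and B: "\<And>k l. norm (G k l) \<le> B k"
  shows "\<exists>X w. finite X \<and> (\<forall>x\<in>X. 0 \<le> snd x \<and> snd x \<le> 1) \<and> (\<forall>x\<in>X. 0 \<le> w x) \<and> 0 < sum w X \<and>
    (\<forall>k l. k < 2 * N \<longrightarrow>
       norm ((\<Sum>x\<in>X. complex_of_real (w x) * strip_monomial k l (fst x) (snd x)) - G k l)
         \<le> (2 * B k * \<bar>real_of_int l\<bar> + 1) / real N)"
proof -
  obtain T w where T: "\<And>y. finite (T y)" "\<And>y t. t \<in> T y \<Longrightarrow> w y t \<ge> 0" "\<And>y. 0 < sum (w y) (T y)"
    and quad: "\<And>y k. k < 2 * N \<Longrightarrow> (\<Sum>t\<in>T y. w y t * t ^ k)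
        = Re (fejer_moment G N y k) + (\<Sum>i<N. (real i / real N) ^ k) / real N ^ 3"
  proof -
    have "\<forall>y. \<exists>T w. finite T \<and> (\<forall>t\<in>T. w t \<ge> 0) \<and> 0 < sum w T \<and> (\<forall>k<2 * N. (\<Sum>t\<in>T. w t * t ^ k)
        = Re (fejer_moment G N y k) + (\<Sum>i<N. (real i / real N) ^ k) / real N ^ 3)"
      using fejer_quadrature[OF PD N] by blast
    from this[unfolded choice_iff] obtain T w where
      "\<forall>y. finite (T y) \<and> (\<forall>t\<in>T y. w y t \<ge> 0) \<and> 0 < sum (w y) (T y) \<and>
        (\<forall>k<2 * N. (\<Sum>t\<in>T y. w y t * t ^ k)
          = Re (fejer_moment G N y k) + (\<Sum>i<N. (real i / real N) ^ k) / real N ^ 3)"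
      by blast
    thus ?thesis by (intro that[of T w]) simp_all
  qed
  define grid where "grid = (\<lambda>j. real j / real N) ` {..<N}"
  have inj: "inj_on (\<lambda>j. real j / real N) {..<N}" using N by (auto simp: inj_on_def)
  define X where "X = prod.swap ` Sigma grid T"
  define W where "W x = w (snd x) (fst x)" for x
  have sumX: "(\<Sum>x\<in>X. f x) = (\<Sum>j<N. \<Sum>t\<in>T (real j / real N). f (t, real j / real N))"
    for f :: "real \<times> real \<Rightarrow> 'a::comm_monoid_add"
  proof -
    have "(\<Sum>x\<in>X. f x) = (\<Sum>(y, t)\<in>Sigma grid T. f (t, y))"
      unfolding X_def by (subst sum.reindex) (auto intro!: sum.cong simp: inj_on_def)
    also have "\<dots> = (\<Sum>y\<in>grid. \<Sum>t\<in>T y. f (t, y))"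
      using T(1) by (subst sum.Sigma) (auto simp: grid_def)
    also have "\<dots> = (\<Sum>j<N. \<Sum>t\<in>T (real j / real N). f (t, real j / real N))"
      unfolding grid_def by (subst sum.reindex[OF inj]) simp
    finally show ?thesis .
  qed
  have "finite X" unfolding X_def grid_def using T(1) by auto
  moreover have "\<forall>x\<in>X. 0 \<le> snd x \<and> snd x \<le> 1"
    by (auto simp: X_def grid_def)
  moreover have "\<forall>x\<in>X. 0 \<le> W x" using T(2) by (auto simp: X_def W_def)
  moreover have "0 < sum W X"
    unfolding sumX W_def using N T(3) by (intro sum_pos[of "{..<N}"]) auto
  moreover have "norm ((\<Sum>x\<in>X. complex_of_real (W x) * strip_monomial k l (fst x) (snd x)) - G k l)
         \<le> (2 * B k * \<bar>real_of_int l\<bar> + 1) / real N" if k: "k < 2 * N" for k l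
  proof -
    define u where "u j = cis (2 * pi * of_int l * (real j / real N))" for j
    define e where "e = (\<Sum>i<N. (real i / real N) ^ k) / real N ^ 3"
    have "(\<Sum>x\<in>X. complex_of_real (W x) * strip_monomial k l (fst x) (snd x))
        = (\<Sum>j<N. u j * of_real (\<Sum>t\<in>T (real j / real N). w (real j / real N) t * t ^ k))"
      unfolding sumX W_def strip_monomial_def u_def
      by (simp add: sum_distrib_left mult_ac)
    also have "\<dots> = (\<Sum>j<N. u j * fejer_moment G N (real j / real N) k + u j * of_real e)"
      unfolding quad[OF k] e_def[symmetric] of_real_add fejer_moment_real[OF PD] distrib_left ..
    also have "\<dots> - G k l = ((\<Sum>j<N. u j * fejer_moment G N (real j / real N) k) - G k l)
        + (\<Sum>j<N. u j * of_real e)" by (simp add: sum.distrib)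
    finally have eq: "(\<Sum>x\<in>X. complex_of_real (W x) * strip_monomial k l (fst x) (snd x)) - G k l
        = ((\<Sum>j<N. u j * fejer_moment G N (real j / real N) k) - G k l) + (\<Sum>j<N. u j * of_real e)" .
    have "norm ((\<Sum>j<N. u j * fejer_moment G N (real j / real N) k) - G k l) \<le> 2 * B k * \<bar>real_of_int l\<bar> / real N"
      unfolding u_def by (rule sum_fejer_moment_error[where G = G, OF N B])
    moreover have "norm (\<Sum>j<N. u j * of_real e) \<le> 1 / real N"
    proof -
      have "(\<Sum>i<N. (real i / real N) ^ k) \<le> (\<Sum>i<N. 1)"
        by (intro sum_mono power_le_one) auto
      hence e1: "0 \<le> e \<and> e \<le> real N / real N ^ 3"
        unfolding e_def by (auto intro!: divide_right_mono divide_nonneg_nonneg sum_nonneg)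
      have "norm (\<Sum>j<N. u j * of_real e) \<le> (\<Sum>j<N. e)"
        using e1 by (intro order.trans[OF norm_sum] sum_mono) (auto simp: u_def norm_mult)
      also have "\<dots> = real N * e" by simp
      also have "\<dots> \<le> real N * (real N / real N ^ 3)" using e1 by (intro mult_left_mono) auto
      also have "\<dots> = 1 / real N" using N by (simp add: power3_eq_cube)
      finally show ?thesis .
    qed
    ultimately show ?thesis unfolding eq add_divide_distrib by (rule norm_triangle_mono)
  qed
  ultimately show ?thesis by blast
qed

text \<open>
  The atomic approximations of order N converge as N grows, and the limit measure, carried by the
  parameter line of the space-filling curve, has the points (R s, Y s) of the strip as its locations. If the
  mass G 0 0 is zero, the approximations cannot be normalised, but then G vanishes identically.
\<close>

theorem strip_moment_representation:
  assumes PD: "strip_positive_definite G"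
  obtains \<sigma> :: "real measure" and R Y :: "real \<Rightarrow> real"
  where "sets \<sigma> = sets borel" "R \<in> borel_measurable borel" "Y \<in> borel_measurable borel"
    and "\<And>k l. integrable \<sigma> (\<lambda>s. strip_monomial k l (R s) (Y s))"
    and "\<And>k l. (LINT s|\<sigma>. strip_monomial k l (R s) (Y s)) = G k l"
proof (cases "G 0 0 = 0")
  case True
  show ?thesis
  proof (rule that)
    show "sets (null_measure borel) = sets (borel :: real measure)" by simp
    show "integrable (null_measure borel) (\<lambda>s. strip_monomial k l ((\<lambda>_. 0) (s::real)) ((\<lambda>_. 0) s))" for k l
      by (simp add: integrable_iff_bounded)
    show "(LINT s|null_measure borel. strip_monomial k l ((\<lambda>_. 0) (s::real)) ((\<lambda>_. 0) s)) = G k l" for k l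
      using strip_positive_definite_eq_0[OF PD True, of k l] by simp
  qed auto
next
  case False
  define B where "B k = Re (G 0 0) + Re (G (2 * k) 0)" for k
  have B: "norm (G k l) \<le> B k" for k l
  proof -
    have "2 * norm (G k l) \<le> B k" using strip_positive_definite_bound[OF PD, of 1 k l] by (simp add: B_def)
    thus ?thesis using norm_ge_zero[of "G k l"] by linarith
  qed
  obtain X w where X: "\<And>n. finite (X n)" "\<And>n x. x \<in> X n \<Longrightarrow> 0 \<le> snd x \<and> snd x \<le> 1"
      "\<And>n x. x \<in> X n \<Longrightarrow> 0 \<le> w n x" "\<And>n. 0 < sum (w n) (X n)"
    and err: "\<And>n k l. k < 2 * Suc n \<Longrightarrow>
      norm ((\<Sum>x\<in>X n. complex_of_real (w n x) * strip_monomial k l (fst x) (snd x)) - G k l)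
         \<le> (2 * B k * \<bar>real_of_int l\<bar> + 1) / real (Suc n)"
  proof -
    have "\<forall>n. \<exists>X w. finite X \<and> (\<forall>x\<in>X. 0 \<le> snd x \<and> snd x \<le> 1) \<and> (\<forall>x\<in>X. 0 \<le> w x) \<and> 0 < sum w X \<and>
      (\<forall>k l. k < 2 * Suc n \<longrightarrow>
       norm ((\<Sum>x\<in>X. complex_of_real (w x) * strip_monomial k l (fst x) (snd x)) - G k l)
         \<le> (2 * B k * \<bar>real_of_int l\<bar> + 1) / real (Suc n))"
      using atomic_approximation[OF PD zero_less_Suc B] by blast
    from this[unfolded choice_iff] obtain X w where
      "\<forall>n. finite (X n) \<and> (\<forall>x\<in>X n. 0 \<le> snd x \<and> snd x \<le> 1) \<and> (\<forall>x\<in>X n. 0 \<le> w n x) \<and> 0 < sum (w n) (X n) \<and>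
      (\<forall>k l. k < 2 * Suc n \<longrightarrow>
       norm ((\<Sum>x\<in>X n. complex_of_real (w n x) * strip_monomial k l (fst x) (snd x)) - G k l)
         \<le> (2 * B k * \<bar>real_of_int l\<bar> + 1) / real (Suc n))"
      by blast
    thus ?thesis by (intro that[of X w]) simp_all
  qed
  have lim: "(\<lambda>n. \<Sum>x\<in>X n. complex_of_real (w n x) * strip_monomial k l (fst x) (snd x)) \<longlonglongrightarrow> G k l" for k l
  proof (rule LIM_zero_cancel, rule Lim_null_comparison)
    show "\<forall>\<^sub>F n in sequentially. norm ((\<Sum>x\<in>X n. complex_of_real (w n x) * strip_monomial k l (fst x) (snd x)) - G k l)
        \<le> (2 * B k * \<bar>real_of_int l\<bar> + 1) / real (Suc n)"
      using eventually_ge_at_top[of k] by eventually_elim (rule err, simp)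
    show "(\<lambda>n. (2 * B k * \<bar>real_of_int l\<bar> + 1) / real (Suc n)) \<longlonglongrightarrow> 0"
      by (rule real_tendsto_divide_at_top[OF tendsto_const])
         (intro filterlim_compose[OF filterlim_real_sequentially filterlim_Suc])
  qed
  show ?thesis
  proof (rule measure_of_convergent_atomic_moments[where X = X and w = w and G = G])
    show "0 \<le> snd x \<and> snd x \<le> 1" if "x \<in> X n" for n x by (rule X(2)[OF that])
    show "0 \<le> w n x" if "x \<in> X n" for n x by (rule X(3)[OF that])
  qed (rule X(1) X(4) lim False | rule that, assumption+)+
qed

section \<open>Polar coordinates on the punctured plane\<close>

lemma NN_subset_NN_plus: "NN \<subseteq> NN_plus"
  by (auto simp: NN_def NN_plus_def)

lemma positive_definiteI:
  assumes "\<And>F c. finite F \<Longrightarrow> F \<subseteq> NN_plus \<Longrightarrow>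
    (\<Sum>x\<in>F. \<Sum>y\<in>F. c x * cnj (c y) * \<Gamma> (fst x + snd y, snd x + fst y)) \<in> \<real>\<^sub>\<ge>\<^sub>0"
  shows "positive_definite \<Gamma>"
  unfolding positive_definite_def Let_def case_prod_unfold
  using assms by simp

lemma positive_definiteD:
  assumes PD: "positive_definite \<Gamma>" and F: "finite F" "F \<subseteq> NN_plus"
  shows "(\<Sum>x\<in>F. \<Sum>y\<in>F. c x * cnj (c y) * \<Gamma> (fst x + snd y, snd x + fst y)) \<in> \<real>\<^sub>\<ge>\<^sub>0"
proof -
  define c' where "c' x = (if x \<in> F then c x else 0)" for x
  define S where "S = {x \<in> NN_plus. c' x \<noteq> 0}"
  have S: "S \<subseteq> F" by (auto simp: S_def c'_def split: if_splits)
  have S0: "c x = 0" if "x \<in> F - S" for x using that F by (auto simp: S_def c'_def split: if_splits)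
  have "(\<Sum>x\<in>S. \<Sum>y\<in>S. c' x * cnj (c' y) * \<Gamma> (fst x + snd y, snd x + fst y)) \<in> \<real>\<^sub>\<ge>\<^sub>0"
    using PD finite_subset[OF S F(1)] unfolding positive_definite_def Let_def case_prod_unfold
    by (simp add: S_def)
  also have "(\<Sum>x\<in>S. \<Sum>y\<in>S. c' x * cnj (c' y) * \<Gamma> (fst x + snd y, snd x + fst y))
      = (\<Sum>x\<in>S. \<Sum>y\<in>S. c x * cnj (c y) * \<Gamma> (fst x + snd y, snd x + fst y))"
    using S by (intro sum.cong refl) (auto simp: c'_def)
  also have "\<dots> = (\<Sum>x\<in>S. \<Sum>y\<in>F. c x * cnj (c y) * \<Gamma> (fst x + snd y, snd x + fst y))"
    using S F S0 by (intro sum.cong refl sum.mono_neutral_left) auto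
  also have "\<dots> = (\<Sum>x\<in>F. \<Sum>y\<in>F. c x * cnj (c y) * \<Gamma> (fst x + snd y, snd x + fst y))"
    using S F S0 by (intro sum.mono_neutral_left) auto
  finally show ?thesis .
qed

text \<open>
  A pair (k, l) is (m + n, m - n) for integers m and n if and only if k and l have the same parity.
\<close>

definition polar_sequence :: "(int \<times> int \<Rightarrow> complex) \<Rightarrow> nat \<Rightarrow> int \<Rightarrow> complex" where
  "polar_sequence \<Gamma> k l = (if even (int k + l) then \<Gamma> ((int k + l) div 2, (int k - l) div 2) else 0)"

lemma polar_sequence_NN_plus:
  assumes "(m, n) \<in> NN_plus"
  shows "polar_sequence \<Gamma> (nat (m + n)) (m - n) = \<Gamma> (m, n)"
proof -
  have "m + n \<ge> 0" using assms by (simp add: NN_plus_def)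
  hence "int (nat (m + n)) + (m - n) = 2 * m" "int (nat (m + n)) - (m - n) = 2 * n" by simp_all
  thus ?thesis unfolding polar_sequence_def by (simp only: dvd_triv_left if_True) simp
qed

lemma half_add_same_parity:
  fixes s t :: int
  assumes "even s = even t"
  shows "(s + t) div 2 = (s + 1) div 2 + t div 2"
  using assms by presburger

lemma half_inj_same_parity:
  fixes s t :: int
  assumes "even s = even t" "(s + 1) div 2 = (t + 1) div 2"
  shows "s = t"
  using assms by presburger

text \<open>
  Pairs of different parity class do not interact, so the form splits into the two classes. On each class it
  is the form of \<Gamma> after the injective substitution \<phi>, which on the odd class differs from the polar
  change of coordinates by a shift of l by 1; such a shift cancels in the difference a - b.
\<close>

lemma strip_positive_definite_polar_sequence:
  assumes PD: "positive_definite \<Gamma>"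
  shows "strip_positive_definite (polar_sequence \<Gamma>)"
  unfolding strip_positive_definite_def
proof (intro allI impI)
  fix F :: "(nat \<times> int) set" and c :: "nat \<times> int \<Rightarrow> complex"
  assume F: "finite F"
  define \<phi> where "\<phi> = (\<lambda>(j::nat, a). ((int j + a + 1) div 2, (int j - a) div 2))"
  define E where "E x \<longleftrightarrow> even (int (fst x) + snd x)" for x :: "nat \<times> int"
  define t where "t x y = c x * cnj (c y) * polar_sequence \<Gamma> (fst x + fst y) (snd x - snd y)" for x y
  have t_eq: "t x y = (if E x = E y then c x * cnj (c y) * \<Gamma> (fst (\<phi> x) + snd (\<phi> y), snd (\<phi> x) + fst (\<phi> y)) else 0)"
    for x y
  proof -
    obtain j a where x: "x = (j, a)" by fastforce
    obtain k b where y: "y = (k, b)" by fastforce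
    show ?thesis
    proof (cases "E x = E y")
      case True
      hence "even (int (j + k) + (a - b))" by (auto simp: E_def x y)
      moreover have "(int (j + k) + (a - b)) div 2 = (int j + a + 1) div 2 + (int k - b) div 2"
      proof -
        have eq: "int (j + k) + (a - b) = (int j + a) + (int k - b)" by simp
        have par: "even (int j + a) = even (int k - b)" using True by (simp add: E_def x y)
        show ?thesis unfolding eq by (rule half_add_same_parity[OF par])
      qed
      moreover have "(int (j + k) - (a - b)) div 2 = (int j - a) div 2 + (int k + b + 1) div 2"
      proof -
        have eq: "int (j + k) - (a - b) = (int k + b) + (int j - a)" by simp
        have par: "even (int k + b) = even (int j - a)" using True by (simp add: E_def x y)
        show ?thesis unfolding eq half_add_same_parity[OF par] by (rule add.commute)
      qed
      ultimately have "polar_sequence \<Gamma> (j + k) (a - b)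
          = \<Gamma> ((int j + a + 1) div 2 + (int k - b) div 2, (int j - a) div 2 + (int k + b + 1) div 2)"
        unfolding polar_sequence_def by (simp only: if_True)
      thus ?thesis using True unfolding t_def x y \<phi>_def by (simp only: fst_conv snd_conv prod.case simp_thms if_True)
    next
      case False
      hence "odd (int (j + k) + (a - b))" by (auto simp: E_def x y)
      hence "polar_sequence \<Gamma> (j + k) (a - b) = 0" unfolding polar_sequence_def by (rule if_not_P)
      thus ?thesis using False by (simp add: t_def x y)
    qed
  qed
  define A where "A = {x \<in> F. E x}"
  define B where "B = {x \<in> F. \<not> E x}"
  have AB: "F = A \<union> B" "A \<inter> B = {}" "finite A" "finite B" using F by (auto simp: A_def B_def)
  have sum_halves: "(int j + a + 1) div 2 + (int j - a) div 2 = int j" for j :: nat and a :: int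
    using half_add_same_parity[of "int j + a" "int j - a"] by simp
  have \<phi>_NN: "\<phi> x \<in> NN_plus" for x
  proof -
    obtain j a where x: "x = (j, a)" by fastforce
    show ?thesis using sum_halves[of j a] by (simp add: x \<phi>_def NN_plus_def)
  qed
  have part: "(\<Sum>x\<in>D. \<Sum>y\<in>D. t x y) \<in> \<real>\<^sub>\<ge>\<^sub>0" if D: "finite D" "\<And>x y. x \<in> D \<Longrightarrow> y \<in> D \<Longrightarrow> E x = E y" for D
  proof -
    have inj: "inj_on \<phi> D"
    proof (rule inj_onI)
      fix x y assume xy: "x \<in> D" "y \<in> D" "\<phi> x = \<phi> y"
      obtain j a where x: "x = (j, a)" by fastforce
      obtain k b where y: "y = (k, b)" by fastforce
      have "E x = E y" using D(2) xy by blast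
      hence par: "even (int j + a) = even (int k + b)" by (simp add: E_def x y)
      have halves: "(int j + a + 1) div 2 = (int k + b + 1) div 2" "(int j - a) div 2 = (int k - b) div 2"
        using xy(3) by (auto simp: x y \<phi>_def)
      have "int j = int k" using sum_halves[of j a] sum_halves[of k b] halves by linarith
      moreover have "int j + a = int k + b" by (rule half_inj_same_parity[OF par halves(1)])
      ultimately have "j = k \<and> a = b" by simp
      thus "x = y" by (simp add: x y)
    qed
    define d where "d = (\<lambda>z. c (inv_into D \<phi> z))"
    have "(\<Sum>x\<in>\<phi> ` D. \<Sum>y\<in>\<phi> ` D. d x * cnj (d y) * \<Gamma> (fst x + snd y, snd x + fst y)) \<in> \<real>\<^sub>\<ge>\<^sub>0"
      using D(1) \<phi>_NN by (intro positive_definiteD[OF PD]) auto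
    also have "(\<Sum>x\<in>\<phi> ` D. \<Sum>y\<in>\<phi> ` D. d x * cnj (d y) * \<Gamma> (fst x + snd y, snd x + fst y))
        = (\<Sum>x\<in>D. \<Sum>y\<in>D. t x y)"
      unfolding sum.reindex[OF inj] o_def
    proof (intro sum.cong refl)
      fix x y assume xy: "x \<in> D" "y \<in> D"
      have "E x = E y" using D(2) xy by blast
      thus "d (\<phi> x) * cnj (d (\<phi> y)) * \<Gamma> (fst (\<phi> x) + snd (\<phi> y), snd (\<phi> x) + fst (\<phi> y)) = t x y"
        using xy by (simp only: t_eq d_def inv_into_f_f[OF inj] simp_thms if_True)
    qed
    finally show ?thesis .
  qed
  have "(\<Sum>x\<in>F. \<Sum>y\<in>F. t x y)
      = (\<Sum>x\<in>A. \<Sum>y\<in>A. t x y) + (\<Sum>x\<in>A. \<Sum>y\<in>B. t x y) + ((\<Sum>x\<in>B. \<Sum>y\<in>A. t x y) + (\<Sum>x\<in>B. \<Sum>y\<in>B. t x y))"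
    using AB by (simp add: sum.union_disjoint sum.distrib)
  also have "(\<Sum>x\<in>A. \<Sum>y\<in>B. t x y) = 0"
    by (intro sum.neutral ballI) (auto simp: t_eq A_def B_def)
  also have "(\<Sum>x\<in>B. \<Sum>y\<in>A. t x y) = 0"
    by (intro sum.neutral ballI) (auto simp: t_eq A_def B_def)
  finally have "(\<Sum>x\<in>F. \<Sum>y\<in>F. t x y) = (\<Sum>x\<in>A. \<Sum>y\<in>A. t x y) + (\<Sum>x\<in>B. \<Sum>y\<in>B. t x y)" by simp
  also have "\<dots> \<in> \<real>\<^sub>\<ge>\<^sub>0"
    using AB by (intro nonneg_Reals_add_I part) (auto simp: A_def B_def)
  finally show "(\<Sum>(j, a)\<in>F. \<Sum>(k, b)\<in>F. c (j, a) * cnj (c (k, b)) * polar_sequence \<Gamma> (j + k) (a - b)) \<in> \<real>\<^sub>\<ge>\<^sub>0"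
    by (simp add: t_def case_prod_unfold)
qed

lemma zmono_polar:
  assumes "r \<noteq> 0" "m + n \<ge> 0"
  shows "zmono m n (of_real r * cis (2 * pi * y)) = strip_monomial (nat (m + n)) (m - n) r y"
proof -
  define u where "u = cis (2 * pi * y)"
  have u0: "u \<noteq> 0" by (simp add: u_def)
  have "cnj u = inverse u" by (simp add: u_def cis_cnj)
  hence "zmono m n (of_real r * u) = (of_real r powi m * of_real r powi n) * (u powi m * u powi (- n))"
    by (simp add: zmono_def power_int_mult_distrib power_int_minus power_int_inverse mult_ac)
  also have "\<dots> = of_real r powi (m + n) * u powi (m - n)"
    using assms u0 by (simp add: power_int_add[symmetric] del: of_real_power_int)
  also have "of_real r powi (m + n) = complex_of_real (r ^ nat (m + n))"
    using assms by (simp add: power_int_def)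
  also have "u powi (m - n) = cis (2 * pi * of_int (m - n) * y)"
    by (simp add: u_def cis_power_int mult_ac)
  finally show ?thesis by (simp add: strip_monomial_def u_def)
qed

lemma zmono_cis:
  assumes "m + n = 0"
  shows "zmono m n (cis (2 * pi * y)) = strip_monomial 0 (m - n) r y"
  using zmono_polar[of 1 m n y] assms by (simp add: strip_monomial_def)

lemma zmono_0_0: "zmono 0 0 = (\<lambda>_. 1)"
  by (simp add: fun_eq_iff zmono_def)

lemma NN_plus_gram_closed:
  "x \<in> NN_plus \<Longrightarrow> y \<in> NN_plus \<Longrightarrow> (fst x + snd y, snd x + fst y) \<in> NN_plus"
  by (auto simp: NN_plus_def)

lemma zmono_at_0: "(m, n) \<in> NN \<Longrightarrow> zmono m n 0 = (if m + n = 0 then 1 else 0)"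
  by (cases "m = 0 \<and> n = 0") (auto simp: zmono_def NN_def)

lemma borel_measurable_zmono [measurable]: "zmono m n \<in> borel_measurable borel"
proof -
  have [measurable]: "(\<lambda>z::complex. z powi k) \<in> borel_measurable borel" for k
    unfolding power_int_def by measurable
  have [measurable]: "cnj \<in> borel_measurable borel"
    by (intro borel_measurable_continuous_onI continuous_intros)
  show ?thesis unfolding zmono_def by measurable
qed

lemma zmono_circle_measurable [measurable]: "zmono m n \<in> borel_measurable (restrict_space borel unit_circle)"
  by (rule measurable_restrict_space1) measurable

lemma norm_zmono_circle:
  assumes "z \<in> unit_circle"
  shows "norm (zmono m n z) = 1"
  using assms by (simp add: zmono_def norm_mult norm_power_int)

lemma space_restrict_unit_circle: "space (restrict_space borel unit_circle) = unit_circle"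
  by (simp add: space_restrict_space)

lemma unit_circle_sets: "unit_circle \<in> sets (restrict_space borel unit_circle)"
  using sets.top[of "restrict_space borel unit_circle"] by (simp add: space_restrict_unit_circle)

text \<open>
  The restriction of a measure to the punctured plane, kept as a measure on the plane.
\<close>

definition off_origin :: "complex measure \<Rightarrow> complex measure" where
  "off_origin \<rho> = density \<rho> (\<lambda>z. ennreal (indicator (- {0}) z))"

text \<open>
  Push the strip measure to the plane along z = r u. Where r is nonzero the monomials agree. Where r = 0, the
  plane retains only a mass at the origin, but the direction u survives in r^0 u^l: that part of the
  strip measure, pushed to the circle along u, is \<nu>.
\<close>

lemma positive_definite_imp_representing:
  assumes PD: "positive_definite \<Gamma>"
  obtains \<rho> \<nu> where "representing_measure \<Gamma> \<rho>"
    and "sets \<nu> = sets (restrict_space borel unit_circle)" "emeasure \<nu> (space \<nu>) = emeasure \<rho> {0}"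
    and "\<And>m n. (m, n) \<in> NN_plus \<Longrightarrow> set_integrable \<rho> (- {0}) (zmono m n)"
    and "\<And>m n. integrable \<nu> (zmono m n)"
    and "\<And>m n. (m, n) \<in> NN_plus \<Longrightarrow>
      \<Gamma> (m, n) = (LINT z:- {0}|\<rho>. zmono m n z) + (if m + n = 0 then 1 else 0) * (LINT z|\<nu>. zmono m n z)"
proof -
  obtain \<sigma> :: "real measure" and R Y :: "real \<Rightarrow> real" where
    sets: "sets \<sigma> = sets borel" and meas: "R \<in> borel_measurable borel" "Y \<in> borel_measurable borel"
    and int: "\<And>k l. integrable \<sigma> (\<lambda>s. strip_monomial k l (R s) (Y s))"
    and val: "\<And>k l. (LINT s|\<sigma>. strip_monomial k l (R s) (Y s)) = polar_sequence \<Gamma> k l"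
    using strip_moment_representation[OF strip_positive_definite_polar_sequence[OF PD]] by blast
  note [measurable_cong] = sets
  note [measurable] = meas
  have space: "space \<sigma> = UNIV" using sets_eq_imp_space_eq[OF sets] by simp
  interpret \<sigma>: finite_measure \<sigma>
  proof
    have "integrable \<sigma> (\<lambda>_. 1::complex)" using int[of 0 0] by (simp add: strip_monomial_def)
    thus "emeasure \<sigma> (space \<sigma>) \<noteq> \<infinity>" by (auto simp: integrable_iff_bounded)
  qed
  define u where "u s = cis (2 * pi * Y s)" for s
  define z where "z s = of_real (R s) * u s" for s
  have u_unit: "u s \<in> unit_circle" for s by (simp add: u_def)
  have u_m [measurable]: "u \<in> borel_measurable borel" unfolding u_def cis_conv_exp by measurable
  have z_m [measurable]: "z \<in> borel_measurable borel" unfolding z_def by measurable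
  have z0: "z s = 0 \<longleftrightarrow> R s = 0" for s by (simp add: z_def u_def)
  \<comment> \<open>The fibre r = 0 contributes an atom at the origin to \<rho>, and its directions make up \<nu>.\<close>
  define \<rho> where "\<rho> = distr \<sigma> borel z"
  define D where "D = density \<sigma> (\<lambda>s. ennreal (indicator {s. R s = 0} s))"
  have [measurable]: "{s. R s = 0} \<in> sets borel" by measurable
  have u_circle [measurable]: "u \<in> measurable D (restrict_space borel unit_circle)"
    unfolding D_def by (rule measurable_restrict_space2) (auto simp: u_def)
  define \<nu> where "\<nu> = distr D (restrict_space borel unit_circle) u"
  have strip_z: "zmono m n (z s) = strip_monomial (nat (m + n)) (m - n) (R s) (Y s)"
    if "R s \<noteq> 0" "(m, n) \<in> NN_plus" for m n s
    using zmono_polar[of "R s" m n "Y s"] that by (simp add: z_def u_def NN_plus_def)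
  have strip_0: "strip_monomial (nat (m + n)) (m - n) (R s) (Y s) = (if m + n = 0 then zmono m n (u s) else 0)"
    if "R s = 0" "(m, n) \<in> NN_plus" for m n s
    using zmono_cis[of m n "Y s" "R s"] that by (auto simp: u_def NN_plus_def strip_monomial_def)
  show ?thesis
  proof (rule that[of \<rho> \<nu>])
    have zz: "zmono m n (z s) = strip_monomial (nat (m + n)) (m - n) (R s) (Y s)" if "(m, n) \<in> NN" for m n s
    proof (cases "R s = 0")
      case True
      hence "zmono m n (z s) = (if m + n = 0 then 1 else 0)"
        using zmono_at_0[OF that] by (simp add: z_def)
      moreover have "m + n = 0 \<Longrightarrow> m = 0 \<and> n = 0" using that by (simp add: NN_def)
      moreover have "(m, n) \<in> NN_plus" using that NN_subset_NN_plus by blast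
      ultimately show ?thesis
        using strip_0[OF True] by (cases "m + n = 0") (auto simp: strip_monomial_def)
    qed (use strip_z that NN_subset_NN_plus in blast)
    show "representing_measure \<Gamma> \<rho>"
      unfolding representing_measure_def
    proof (intro conjI ballI, goal_cases)
      case (2 x)
      obtain m n where x: "x = (m, n)" by fastforce
      have mn: "(m, n) \<in> NN" "(m, n) \<in> NN_plus" using 2 NN_subset_NN_plus by (auto simp: x)
      have "integrable \<rho> (zmono m n)"
        unfolding \<rho>_def using int by (subst integrable_distr_eq) (auto simp: zz[OF mn(1)])
      moreover have "(LINT z|\<rho>. zmono m n z) = \<Gamma> (m, n)"
        unfolding \<rho>_def using polar_sequence_NN_plus[OF mn(2), of \<Gamma>] val
        by (subst integral_distr) (auto simp: zz[OF mn(1)])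
      ultimately show ?case by (simp add: x)
    qed (simp add: \<rho>_def)
    show "sets \<nu> = sets (restrict_space borel unit_circle)" by (simp add: \<nu>_def)
    show "emeasure \<nu> (space \<nu>) = emeasure \<rho> {0}"
    proof -
      have "emeasure \<nu> (space \<nu>) = emeasure D (space D)"
        unfolding \<nu>_def using measurable_space[OF u_circle] unit_circle_sets
        by (subst emeasure_distr) (auto intro!: arg_cong[of _ _ "emeasure D"])
      also have "\<dots> = emeasure \<sigma> {s. R s = 0}"
        by (simp add: D_def emeasure_density space ennreal_indicator)
      also have "{s. R s = 0} = z -` {0} \<inter> space \<sigma>" by (auto simp: z0 space)
      also have "emeasure \<sigma> \<dots> = emeasure \<rho> {0}" unfolding \<rho>_def by (subst emeasure_distr) auto
      finally show ?thesis .
    qed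
    have off: "indicator (- {0}) (z s) *\<^sub>R zmono m n (z s)
        = indicator {s. R s \<noteq> 0} s *\<^sub>R strip_monomial (nat (m + n)) (m - n) (R s) (Y s)"
      if "(m, n) \<in> NN_plus" for m n s
      using strip_z[OF _ that, of s] by (auto simp: z0 split: split_indicator)
    have off_int: "integrable \<sigma> (\<lambda>s. indicator {s. R s \<noteq> 0} s *\<^sub>R strip_monomial k l (R s) (Y s))" for k l
      by (rule integrable_mult_indicator[OF _ int]) measurable
    show "set_integrable \<rho> (- {0}) (zmono m n)" if "(m, n) \<in> NN_plus" for m n
      unfolding set_integrable_def \<rho>_def using off_int
      by (subst integrable_distr_eq) (auto simp: off[OF that])
    have on_int: "integrable \<sigma> (\<lambda>s. indicator {s. R s = 0} s *\<^sub>R zmono m n (u s))" for m n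
      by (rule \<sigma>.integrable_const_bound[where B = 1])
         (use norm_zmono_circle[OF u_unit] in \<open>auto split: split_indicator\<close>)
    show "integrable \<nu> (zmono m n)" for m n
      unfolding \<nu>_def D_def using u_circle[unfolded D_def]
      by (subst integrable_distr_eq) (auto simp: integrable_density on_int)
    show "\<Gamma> (m, n) = (LINT z:- {0}|\<rho>. zmono m n z)
        + (if m + n = 0 then 1 else 0) * (LINT z|\<nu>. zmono m n z)" if mn: "(m, n) \<in> NN_plus" for m n
    proof -
      have "(LINT z:- {0}|\<rho>. zmono m n z)
          = (LINT s|\<sigma>. indicator {s. R s \<noteq> 0} s *\<^sub>R strip_monomial (nat (m + n)) (m - n) (R s) (Y s))"
        unfolding set_lebesgue_integral_def \<rho>_def by (subst integral_distr) (auto simp: off[OF mn])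
      moreover have "(LINT z|\<nu>. zmono m n z) = (LINT s|\<sigma>. indicator {s. R s = 0} s *\<^sub>R zmono m n (u s))"
        unfolding \<nu>_def D_def using u_circle[unfolded D_def]
        by (subst integral_distr) (auto simp: integral_density)
      moreover have "(LINT s|\<sigma>. (if m + n = 0 then 1 else 0) * (indicator {s. R s = 0} s *\<^sub>R zmono m n (u s)))
          = (if m + n = 0 then 1 else 0) * (LINT s|\<sigma>. indicator {s. R s = 0} s *\<^sub>R zmono m n (u s))"
        by (rule integral_mult_right_zero)
      moreover have "\<Gamma> (m, n) = (LINT s|\<sigma>. strip_monomial (nat (m + n)) (m - n) (R s) (Y s))"
        using polar_sequence_NN_plus[OF mn] val by simp
      moreover have "(LINT s|\<sigma>. strip_monomial (nat (m + n)) (m - n) (R s) (Y s))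
          = (LINT s|\<sigma>. indicator {s. R s \<noteq> 0} s *\<^sub>R strip_monomial (nat (m + n)) (m - n) (R s) (Y s)
              + (if m + n = 0 then 1 else 0) * (indicator {s. R s = 0} s *\<^sub>R zmono m n (u s)))"
        using strip_0[OF _ mn]
        by (intro Bochner_Integration.integral_cong refl) (auto split: split_indicator)
      ultimately show ?thesis using off_int on_int
        by (subst (asm) Bochner_Integration.integral_add) auto
    qed
  qed
qed

section \<open>Representing pairs and positive definite extensions\<close>

lemma sets_off_origin [simp]: "sets (off_origin \<rho>) = sets \<rho>"
  by (simp add: off_origin_def)

lemma emeasure_off_origin:
  assumes "sets \<rho> = sets borel" "A \<in> sets borel"
  shows "emeasure (off_origin \<rho>) A = emeasure \<rho> (A - {0})"
proof -
  have [measurable]: "A \<in> sets \<rho>" "- {0} \<in> sets \<rho>" using assms by simp_all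
  have "emeasure (off_origin \<rho>) A = (\<integral>\<^sup>+ z. indicator (- {0}) z * indicator A z \<partial>\<rho>)"
    unfolding off_origin_def by (subst emeasure_density) (auto simp: ennreal_indicator)
  also have "\<dots> = (\<integral>\<^sup>+ z. indicator (A - {0}) z \<partial>\<rho>)"
    by (intro nn_integral_cong) (auto split: split_indicator)
  also have "\<dots> = emeasure \<rho> (A - {0})" using assms by (intro nn_integral_indicator) auto
  finally show ?thesis .
qed

text \<open>
  Identifies measures on the punctured plane with measures on the plane that do not charge the origin.
\<close>

lemma off_origin_eq:
  assumes "sets \<rho> = sets borel" "emeasure \<rho> {0} = 0"
  shows "off_origin \<rho> = \<rho>"
proof (rule measure_eqI)
  fix A assume "A \<in> sets (off_origin \<rho>)"
  hence A: "A \<in> sets borel" "A \<in> sets \<rho>" using assms by simp_all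
  have "{0} \<in> null_sets \<rho>" using assms by (auto simp: null_sets_def)
  thus "emeasure (off_origin \<rho>) A = emeasure \<rho> A"
    using A assms by (simp add: emeasure_off_origin emeasure_Diff_null_set)
qed simp

lemma
  fixes f :: "complex \<Rightarrow> complex"
  assumes sets: "sets \<rho> = sets borel" and f: "f \<in> borel_measurable borel"
  shows set_integrable_off_origin: "set_integrable (off_origin \<rho>) (- {0}) f \<longleftrightarrow> set_integrable \<rho> (- {0}) f"
    and set_integral_off_origin: "(LINT z:- {0}|off_origin \<rho>. f z) = (LINT z:- {0}|\<rho>. f z)"
proof -
  note [measurable_cong] = sets
  note [measurable] = f
  have eq: "indicator (- {0}) z * indicator (- {0}) z = (indicator (- {0}) z :: real)" for z :: complex
    by (simp split: split_indicator)
  show "set_integrable (off_origin \<rho>) (- {0}) f \<longleftrightarrow> set_integrable \<rho> (- {0}) f"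
    unfolding set_integrable_def off_origin_def by (subst integrable_density) (auto simp: eq)
  show "(LINT z:- {0}|off_origin \<rho>. f z) = (LINT z:- {0}|\<rho>. f z)"
    unfolding set_lebesgue_integral_def off_origin_def by (subst integral_density) (auto simp: eq)
qed

text \<open>
  The conditions on a representing pair that do not mention the sequence.
\<close>

definition moment_pair :: "complex measure \<Rightarrow> complex measure \<Rightarrow> bool" where
  "moment_pair \<mu> \<nu> \<longleftrightarrow> sets \<mu> = sets borel \<and> emeasure \<mu> {0} = 0 \<and>
     sets \<nu> = sets (restrict_space borel unit_circle) \<and>
     (\<forall>(m, n) \<in> NN_plus. set_integrable \<mu> (- {0}) (zmono m n) \<and> integrable \<nu> (zmono m n))"

definition pair_moments :: "complex measure \<Rightarrow> complex measure \<Rightarrow> int \<times> int \<Rightarrow> complex" where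
  "pair_moments \<mu> \<nu> = restrict (\<lambda>(m, n). (LINT z:- {0}|\<mu>. zmono m n z)
                  + (if m + n = 0 then 1 else 0) * (LINT z|\<nu>. zmono m n z)) NN_plus"

lemma representing_pair_iff:
  "representing_pair \<Gamma> (\<mu>, \<nu>) \<longleftrightarrow> moment_pair \<mu> \<nu> \<and> (\<forall>x\<in>NN_plus. \<Gamma> x = pair_moments \<mu> \<nu> x)"
  by (auto simp: representing_pair_def moment_pair_def pair_moments_def)

text \<open>
  For characters \<phi> of the half plane the form is the integral of the square of |\<Sum> c x * \<phi> x|.
\<close>

lemma gram_integral_nonneg:
  fixes \<phi> :: "int \<times> int \<Rightarrow> 'a \<Rightarrow> complex"
  assumes int: "\<And>x. x \<in> NN_plus \<Longrightarrow> integrable M (\<phi> x)"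
    and mult: "\<And>x y w. x \<in> NN_plus \<Longrightarrow> y \<in> NN_plus \<Longrightarrow>
      \<phi> (fst x + snd y, snd x + fst y) w = \<phi> x w * cnj (\<phi> y w)"
    and F: "finite F" "F \<subseteq> NN_plus"
  shows "(\<Sum>x\<in>F. \<Sum>y\<in>F. c x * cnj (c y) * (LINT w|M. \<phi> (fst x + snd y, snd x + fst y) w)) \<in> \<real>\<^sub>\<ge>\<^sub>0"
proof -
  have int2: "integrable M (\<phi> (fst x + snd y, snd x + fst y))" if "x \<in> F" "y \<in> F" for x y
    using that F(2) by (intro int NN_plus_gram_closed) auto
  have sq: "(\<Sum>x\<in>F. \<Sum>y\<in>F. c x * cnj (c y) * \<phi> (fst x + snd y, snd x + fst y) w)
      = complex_of_real (norm (\<Sum>x\<in>F. c x * \<phi> x w)^2)" for w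
  proof -
    have "(\<Sum>x\<in>F. \<Sum>y\<in>F. c x * cnj (c y) * \<phi> (fst x + snd y, snd x + fst y) w)
        = (\<Sum>x\<in>F. \<Sum>y\<in>F. (c x * \<phi> x w) * cnj (c y * \<phi> y w))"
    proof (intro sum.cong refl)
      fix x y assume "x \<in> F" "y \<in> F"
      hence "x \<in> NN_plus" "y \<in> NN_plus" using F(2) by auto
      from mult[OF this] show "c x * cnj (c y) * \<phi> (fst x + snd y, snd x + fst y) w
          = (c x * \<phi> x w) * cnj (c y * \<phi> y w)" by simp
    qed
    also have "\<dots> = (\<Sum>x\<in>F. c x * \<phi> x w) * cnj (\<Sum>x\<in>F. c x * \<phi> x w)"
      by (simp add: sum_product)
    finally show ?thesis by (simp only: complex_norm_square)
  qed
  have "(\<Sum>x\<in>F. \<Sum>y\<in>F. c x * cnj (c y) * (LINT w|M. \<phi> (fst x + snd y, snd x + fst y) w))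
      = (LINT w|M. (\<Sum>x\<in>F. \<Sum>y\<in>F. c x * cnj (c y) * \<phi> (fst x + snd y, snd x + fst y) w))"
    using int2 by (simp add: Bochner_Integration.integral_sum)
  also have "\<dots> = complex_of_real (LINT w|M. norm (\<Sum>x\<in>F. c x * \<phi> x w)^2)"
    unfolding sq by (rule integral_complex_of_real)
  also have "\<dots> \<in> \<real>\<^sub>\<ge>\<^sub>0" by (simp add: integral_nonneg)
  finally show ?thesis .
qed

lemma zmono_gram:
  assumes "z \<noteq> 0"
  shows "zmono (m + q) (n + p) z = zmono m n z * cnj (zmono p q z)"
  using assms by (simp add: zmono_def power_int_add mult_ac)

text \<open>
  Both parts are integrals of characters. For the circle part the character is the monomial times the
  indicator of m + n = 0, which is multiplicative because m + n and p + q are nonnegative and thus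
  have sum 0 only if both vanish.
\<close>

lemma positive_definite_pair_moments:
  assumes "moment_pair \<mu> \<nu>"
  shows "positive_definite (pair_moments \<mu> \<nu>)"
proof (rule positive_definiteI)
  fix F and c :: "int \<times> int \<Rightarrow> complex"
  assume F: "finite F" "F \<subseteq> NN_plus"
  define \<phi> where "\<phi> x z = indicator (- {0}) z *\<^sub>R zmono (fst x) (snd x) z" for x z
  define \<psi> where "\<psi> x z = (if fst x + snd x = 0 then indicator unit_circle z *\<^sub>R zmono (fst x) (snd x) z else 0)" for x z
  have circ: "z \<in> unit_circle" if "z \<in> space \<nu>" for z
  proof -
    have "space \<nu> = unit_circle"
      using assms sets_eq_imp_space_eq[of \<nu> "restrict_space borel unit_circle"]
      by (simp add: moment_pair_def space_restrict_unit_circle)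
    thus ?thesis using that by simp
  qed
  have \<psi>_int: "(LINT z|\<nu>. \<psi> x z) = (if fst x + snd x = 0 then 1 else 0) * (LINT z|\<nu>. zmono (fst x) (snd x) z)" for x
  proof (cases "fst x + snd x = 0")
    case True
    have "(LINT z|\<nu>. \<psi> x z) = (LINT z|\<nu>. zmono (fst x) (snd x) z)"
      by (intro Bochner_Integration.integral_cong refl)
         (simp only: \<psi>_def True simp_thms if_True indicator_simps(1)[OF circ] scaleR_one)
    thus ?thesis using True by simp
  qed (simp add: \<psi>_def)
  have \<psi>_integrable: "integrable \<nu> (\<psi> x)" if "x \<in> NN_plus" for x
  proof (cases "fst x + snd x = 0")
    case True
    have "integrable \<nu> (zmono (fst x) (snd x))" using assms that by (auto simp: moment_pair_def)
    also have "integrable \<nu> (zmono (fst x) (snd x)) \<longleftrightarrow> integrable \<nu> (\<psi> x)"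
      by (intro Bochner_Integration.integrable_cong refl)
         (simp only: \<psi>_def True simp_thms if_True indicator_simps(1)[OF circ] scaleR_one)
    finally show ?thesis .
  qed (simp add: \<psi>_def[abs_def])
  have eq: "pair_moments \<mu> \<nu> x = (LINT z|\<mu>. \<phi> x z) + (LINT z|\<nu>. \<psi> x z)" if "x \<in> NN_plus" for x
    using that by (auto simp: pair_moments_def \<phi>_def[abs_def] \<psi>_int set_lebesgue_integral_def split: prod.splits)
  have closed: "(fst x + snd y, snd x + fst y) \<in> NN_plus" if "x \<in> F" "y \<in> F" for x y
    using that F(2) by (intro NN_plus_gram_closed) auto
  have "(\<Sum>x\<in>F. \<Sum>y\<in>F. c x * cnj (c y) * (LINT z|\<mu>. \<phi> (fst x + snd y, snd x + fst y) z)) \<in> \<real>\<^sub>\<ge>\<^sub>0"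
  proof (rule gram_integral_nonneg[OF _ _ F])
    show "integrable \<mu> (\<phi> x)" if "x \<in> NN_plus" for x
      using that assms by (auto simp: moment_pair_def \<phi>_def[abs_def] set_integrable_def)
    show "\<phi> (fst x + snd y, snd x + fst y) w = \<phi> x w * cnj (\<phi> y w)" for x y w
      using zmono_gram[of w "fst x" "snd y" "snd x" "fst y"] by (simp add: \<phi>_def split: split_indicator)
  qed
  moreover have "(\<Sum>x\<in>F. \<Sum>y\<in>F. c x * cnj (c y) * (LINT z|\<nu>. \<psi> (fst x + snd y, snd x + fst y) z)) \<in> \<real>\<^sub>\<ge>\<^sub>0"
  proof (rule gram_integral_nonneg[OF _ _ F])
    show "integrable \<nu> (\<psi> x)" if "x \<in> NN_plus" for x by (rule \<psi>_integrable[OF that])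
    show "\<psi> (fst x + snd y, snd x + fst y) w = \<psi> x w * cnj (\<psi> y w)"
      if "x \<in> NN_plus" "y \<in> NN_plus" for x y w
    proof -
      have "fst x + snd x \<ge> 0" "fst y + snd y \<ge> 0" using that by (auto simp: NN_plus_def)
      hence "fst x + snd y + (snd x + fst y) = 0 \<longleftrightarrow> fst x + snd x = 0 \<and> fst y + snd y = 0" by linarith
      moreover have "w \<noteq> 0" if "w \<in> unit_circle" using that by auto
      ultimately show ?thesis using zmono_gram[of w "fst x" "snd y" "snd x" "fst y"]
        unfolding \<psi>_def fst_conv snd_conv by (cases "w \<in> unit_circle") auto
    qed
  qed
  moreover have "(\<Sum>x\<in>F. \<Sum>y\<in>F. c x * cnj (c y) * pair_moments \<mu> \<nu> (fst x + snd y, snd x + fst y))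
    = (\<Sum>x\<in>F. \<Sum>y\<in>F. c x * cnj (c y) * (LINT z|\<mu>. \<phi> (fst x + snd y, snd x + fst y) z))
    + (\<Sum>x\<in>F. \<Sum>y\<in>F. c x * cnj (c y) * (LINT z|\<nu>. \<psi> (fst x + snd y, snd x + fst y) z))"
    unfolding sum.distrib[symmetric] distrib_left[symmetric]
    by (intro sum.cong refl) (simp only: eq closed)
  ultimately show "(\<Sum>x\<in>F. \<Sum>y\<in>F. c x * cnj (c y) * pair_moments \<mu> \<nu> (fst x + snd y, snd x + fst y)) \<in> \<real>\<^sub>\<ge>\<^sub>0"
    by (simp only: nonneg_Reals_add_I)
qed

lemma pair_moments_in_PDE_iff:
  assumes "moment_pair \<mu> \<nu>"
  shows "pair_moments \<mu> \<nu> \<in> PDE \<gamma> \<longleftrightarrow> (\<forall>x\<in>NN. pair_moments \<mu> \<nu> x = \<gamma> x)"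
  using positive_definite_pair_moments[OF assms] by (simp add: PDE_def pair_moments_def)

text \<open>
  The modulus of z^m * cnj z^n is |z|^(m + n), and with k = m + n it is at most 1 + |z|^(2 k), a sum of two
  integrable moments.
\<close>

lemma set_integrable_zmono:
  assumes sets: "sets \<rho> = sets borel" and int: "\<And>m n. (m, n) \<in> NN \<Longrightarrow> integrable \<rho> (zmono m n)"
    and mn: "(m, n) \<in> NN_plus"
  shows "set_integrable \<rho> (- {0}) (zmono m n)"
proof -
  note [measurable_cong] = sets
  define k where "k = m + n"
  have k: "k \<ge> 0" using mn by (simp add: k_def NN_plus_def)
  have dom: "integrable \<rho> (\<lambda>z. norm (zmono 0 0 z) + norm (zmono k k z))"
    using k by (intro Bochner_Integration.integrable_add integrable_norm int) (auto simp: NN_def)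
  have bound: "norm (zmono m n z) \<le> norm (zmono 0 0 z) + norm (zmono k k z)" if "z \<noteq> 0" for z
  proof -
    have "norm (zmono m n z) = norm z powi k"
      using that by (simp add: zmono_def k_def norm_mult norm_power_int power_int_add)
    also have "\<dots> = norm z ^ nat k" using k by (simp add: power_int_def)
    also have "\<dots> \<le> 1 + norm z ^ nat k * norm z ^ nat k"
      using zero_le_power2[of "norm z ^ nat k - 1/2"] by (simp add: power2_eq_square algebra_simps)
    also have "\<dots> = norm (zmono 0 0 z) + norm (zmono k k z)"
      using k by (simp add: zmono_def power_int_def norm_mult norm_power)
    finally show ?thesis .
  qed
  show ?thesis unfolding set_integrable_def
  proof (rule Bochner_Integration.integrable_bound[OF dom])
    show "(\<lambda>z. indicator (- {0}) z *\<^sub>R zmono m n z) \<in> borel_measurable \<rho>" by measurable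
    show "AE z in \<rho>. norm (indicator (- {0}) z *\<^sub>R zmono m n z)
        \<le> norm (norm (zmono 0 0 z) + norm (zmono k k z))"
    proof (rule AE_I2)
      fix z
      show "norm (indicator (- {0}) z *\<^sub>R zmono m n z) \<le> norm (norm (zmono 0 0 z) + norm (zmono k k z))"
        using bound[of z] by (cases "z = 0") auto
    qed
  qed
qed

lemma representing_measure_integral_split:
  assumes \<rho>: "representing_measure \<gamma> \<rho>" and mn: "(m, n) \<in> NN"
  shows "\<gamma> (m, n) = (LINT z:- {0}|\<rho>. zmono m n z) + (if m + n = 0 then 1 else 0) * of_real (measure \<rho> {0})"
proof -
  have sets: "sets \<rho> = sets borel" and int: "\<And>m n. (m, n) \<in> NN \<Longrightarrow> integrable \<rho> (zmono m n)"
    and val: "\<gamma> (m, n) = (LINT z|\<rho>. zmono m n z)"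
    using \<rho> mn by (auto simp: representing_measure_def)
  have [measurable]: "{0} \<in> sets \<rho>" using sets by simp
  have fin: "emeasure \<rho> {0} < \<infinity>"
  proof -
    have "integrable \<rho> (\<lambda>_. 1::complex)" using int[of 0 0] by (simp add: NN_def zmono_0_0)
    hence "emeasure \<rho> (space \<rho>) < \<infinity>" by (auto simp: integrable_iff_bounded)
    thus ?thesis using emeasure_space[of \<rho> "{0}"] le_less_trans by blast
  qed
  have off: "integrable \<rho> (\<lambda>z. indicator (- {0}) z *\<^sub>R zmono m n z)"
    using set_integrable_zmono[OF sets int] mn NN_subset_NN_plus by (auto simp: set_integrable_def)
  have on: "integrable \<rho> (\<lambda>z. indicator {0} z *\<^sub>R zmono m n 0)"
    using fin by (intro integrable_scaleR_left integrable_real_indicator) auto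
  have "(LINT z|\<rho>. zmono m n z)
      = (LINT z|\<rho>. indicator (- {0}) z *\<^sub>R zmono m n z + indicator {0} z *\<^sub>R zmono m n 0)"
    by (intro Bochner_Integration.integral_cong refl) (auto split: split_indicator)
  also have "\<dots> = (LINT z:- {0}|\<rho>. zmono m n z) + (LINT z|\<rho>. indicator {0} z *\<^sub>R zmono m n 0)"
    unfolding set_lebesgue_integral_def by (rule Bochner_Integration.integral_add[OF off on])
  also have "(LINT z|\<rho>. indicator {0} z *\<^sub>R zmono m n 0) = measure \<rho> {0} *\<^sub>R zmono m n 0"
    using fin by (simp add: sets_eq_imp_space_eq[OF sets])
  finally show ?thesis using zmono_at_0[OF mn] by (simp add: val scaleR_conv_of_real)
qed

definition circle_atom :: "real \<Rightarrow> complex \<Rightarrow> complex measure" where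
  "circle_atom c u = density (return (restrict_space borel unit_circle) u) (\<lambda>_. ennreal c)"

lemma circle_atom:
  assumes "c \<ge> 0" "u \<in> unit_circle"
  shows "sets (circle_atom c u) = sets (restrict_space borel unit_circle)"
    and "integrable (circle_atom c u) (zmono m n)"
    and "(LINT z|circle_atom c u. zmono m n z) = of_real c * zmono m n u"
    and "emeasure (circle_atom c u) (space (circle_atom c u)) = ennreal c"
proof -
  let ?K = "restrict_space borel unit_circle :: complex measure"
  have u: "u \<in> space ?K" using assms(2) by (simp add: space_restrict_unit_circle)
  show "sets (circle_atom c u) = sets ?K" by (simp add: circle_atom_def)
  have zm: "zmono m n \<in> borel_measurable (return ?K u)" by simp
  interpret prob_space "return ?K u" by (rule prob_space_return[OF u])
  have "integrable (return ?K u) (\<lambda>z. c *\<^sub>R zmono m n z)"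
    by (rule integrable_const_bound[where B = c])
       (use assms(1) in \<open>auto simp: norm_zmono_circle space_restrict_unit_circle\<close>)
  thus "integrable (circle_atom c u) (zmono m n)"
    unfolding circle_atom_def using assms(1) zm by (subst integrable_density) auto
  show "(LINT z|circle_atom c u. zmono m n z) = of_real c * zmono m n u"
    unfolding circle_atom_def using assms(1) zm u
    by (subst integral_density) (auto simp: integral_return scaleR_conv_of_real)
  show "emeasure (circle_atom c u) (space (circle_atom c u)) = ennreal c"
    unfolding circle_atom_def using emeasure_space_1 unit_circle_sets
    by (simp add: emeasure_density_const space_restrict_unit_circle)
qed

lemma moment_pair_mass:
  assumes "moment_pair \<mu> \<nu>"
  shows "emeasure \<nu> (space \<nu>) = ennreal (measure \<nu> (space \<nu>))"
    and "(LINT z|\<nu>. zmono 0 0 z) = of_real (measure \<nu> (space \<nu>))"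
proof -
  have "integrable \<nu> (zmono 0 0)" using assms by (auto simp: moment_pair_def NN_plus_def)
  hence int: "integrable \<nu> (\<lambda>_. 1::complex)" by (simp only: zmono_0_0)
  hence "emeasure \<nu> (space \<nu>) < \<infinity>" by (auto simp: integrable_iff_bounded)
  thus "emeasure \<nu> (space \<nu>) = ennreal (measure \<nu> (space \<nu>))"
    by (intro emeasure_eq_ennreal_measure) auto
  show "(LINT z|\<nu>. zmono 0 0 z) = of_real (measure \<nu> (space \<nu>))"
    by (simp add: zmono_0_0 scaleR_conv_of_real)
qed

lemma zero_mass_imp_zero_circle_measure:
  assumes sets: "sets \<nu> = sets (restrict_space borel unit_circle)" and "emeasure \<nu> (space \<nu>) = 0"
  shows "\<nu> = zero_circle_measure"
proof (rule measure_eqI)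
  show "sets \<nu> = sets zero_circle_measure" using sets by simp
  fix A assume "A \<in> sets \<nu>"
  thus "emeasure \<nu> A = emeasure zero_circle_measure A"
    using emeasure_space[of \<nu> A] assms(2) by simp
qed

text \<open>
  The quadrant meets the line m + n = 0 only at (0, 0), so it sees nothing of the circle measure except its
  total mass.
\<close>

lemma pair_moments_circle_atom_NN:
  assumes "moment_pair \<mu> \<nu>" "u \<in> unit_circle" "x \<in> NN"
  shows "pair_moments \<mu> (circle_atom (measure \<nu> (space \<nu>)) u) x = pair_moments \<mu> \<nu> x"
proof -
  obtain m n where x: "x = (m, n)" by fastforce
  show ?thesis
  proof (cases "m + n = 0")
    case True
    hence "m = 0" "n = 0" using assms(3) by (auto simp: x NN_def)
    moreover have "(LINT z|circle_atom (measure \<nu> (space \<nu>)) u. zmono 0 0 z) = (LINT z|\<nu>. zmono 0 0 z)"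
      unfolding moment_pair_mass(2)[OF assms(1)] circle_atom(3)[OF measure_nonneg assms(2)]
      by (simp add: zmono_0_0)
    ultimately show ?thesis by (simp add: pair_moments_def x)
  next
    case False
    thus ?thesis by (simp add: pair_moments_def x)
  qed
qed

text \<open>
  Concentrating the mass c of \<nu> at any point u of the circle gives another positive definite extension,
  so its value c u^2 at (1, -1), up to the contribution of \<mu>, is the same for u = 1 and u = \<i>.
\<close>

lemma PDE_singleton_imp_no_circle_part:
  assumes PDE: "PDE \<gamma> = {\<Gamma>}" and rep: "representing_pair \<Gamma> (\<mu>, \<nu>)"
  shows "\<nu> = zero_circle_measure"
proof -
  have mp: "moment_pair \<mu> \<nu>" and \<Gamma>: "\<And>x. x \<in> NN_plus \<Longrightarrow> \<Gamma> x = pair_moments \<mu> \<nu> x"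
    using rep by (auto simp: representing_pair_iff)
  define c where "c = measure \<nu> (space \<nu>)"
  have "c \<ge> 0" by (simp add: c_def)
  have "pair_moments \<mu> (circle_atom c u) = \<Gamma>" if u: "u \<in> unit_circle" for u
  proof -
    have "moment_pair \<mu> (circle_atom c u)"
      using mp circle_atom[OF \<open>c \<ge> 0\<close> u] by (auto simp: moment_pair_def)
    moreover have "pair_moments \<mu> (circle_atom c u) x = \<gamma> x" if "x \<in> NN" for x
    proof -
      have "\<Gamma> x = \<gamma> x" using PDE that by (auto simp: PDE_def)
      thus ?thesis unfolding c_def pair_moments_circle_atom_NN[OF mp u that]
        using \<Gamma>[of x] that NN_subset_NN_plus by auto
    qed
    ultimately have "pair_moments \<mu> (circle_atom c u) \<in> PDE \<gamma>"
      using pair_moments_in_PDE_iff by blast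
    thus ?thesis using PDE by simp
  qed
  from this[of 1] this[of \<i>]
  have "pair_moments \<mu> (circle_atom c 1) (1, - 1) = pair_moments \<mu> (circle_atom c \<i>) (1, - 1)" by simp
  hence "of_real c * zmono 1 (- 1) 1 = of_real c * zmono 1 (- 1) \<i>"
    using circle_atom(3)[OF \<open>c \<ge> 0\<close>, of 1] circle_atom(3)[OF \<open>c \<ge> 0\<close>, of \<i>]
    by (simp add: pair_moments_def NN_plus_def)
  hence "c = 0" by (simp add: zmono_def power_int_minus)
  hence "emeasure \<nu> (space \<nu>) = 0" using moment_pair_mass(1)[OF mp] by (simp add: c_def)
  thus ?thesis using mp zero_mass_imp_zero_circle_measure by (auto simp: moment_pair_def)
qed

lemma moment_pair_zero_iff:
  "moment_pair \<mu> zero_circle_measure \<longleftrightarrow> sets \<mu> = sets borel \<and> emeasure \<mu> {0} = 0 \<and>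
     (\<forall>(m, n) \<in> NN_plus. set_integrable \<mu> (- {0}) (zmono m n))"
proof -
  have "integrable zero_circle_measure (zmono m n)" for m n
    by (auto simp: integrable_iff_bounded)
  thus ?thesis by (auto simp: moment_pair_def)
qed

lemma moment_pair_off_origin:
  assumes "representing_measure \<gamma> \<rho>" and "c \<ge> 0" "u \<in> unit_circle"
  shows "moment_pair (off_origin \<rho>) (circle_atom c u)"
proof -
  have sets: "sets \<rho> = sets borel" and int: "\<And>m n. (m, n) \<in> NN \<Longrightarrow> integrable \<rho> (zmono m n)"
    using assms(1) by (auto simp: representing_measure_def)
  show ?thesis unfolding moment_pair_def
    using set_integrable_zmono[OF sets int] circle_atom[OF assms(2,3)]
    by (auto simp: sets emeasure_off_origin[OF sets] set_integrable_off_origin[OF sets])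
qed

lemma pair_moments_off_origin:
  assumes \<rho>: "representing_measure \<gamma> \<rho>" and u: "u \<in> unit_circle" and x: "x \<in> NN"
  shows "pair_moments (off_origin \<rho>) (circle_atom (measure \<rho> {0}) u) x = \<gamma> x"
proof -
  obtain m n where mn: "x = (m, n)" by fastforce
  have sets: "sets \<rho> = sets borel" using \<rho> by (simp add: representing_measure_def)
  have "m + n = 0 \<Longrightarrow> m = 0 \<and> n = 0" using x by (auto simp: mn NN_def)
  hence atom: "(if m + n = 0 then 1 else 0) * (of_real (measure \<rho> {0}) * zmono m n u)
      = (if m + n = 0 then 1 else 0) * of_real (measure \<rho> {0})"
    by (cases "m + n = 0") (auto simp: zmono_0_0)
  have "(m, n) \<in> NN" "(m, n) \<in> NN_plus" using x NN_subset_NN_plus by (auto simp: mn)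
  hence "pair_moments (off_origin \<rho>) (circle_atom (measure \<rho> {0}) u) x
      = (LINT z:- {0}|\<rho>. zmono m n z) + (if m + n = 0 then 1 else 0) * (of_real (measure \<rho> {0}) * zmono m n u)"
    unfolding pair_moments_def mn set_integral_off_origin[OF sets borel_measurable_zmono]
      circle_atom(3)[OF measure_nonneg u] by simp
  also have "\<dots> = \<gamma> (m, n)"
    unfolding atom by (rule representing_measure_integral_split[OF \<rho> \<open>(m, n) \<in> NN\<close>, symmetric])
  finally show ?thesis by (simp add: mn)
qed

text \<open>
  Moving the atom of \<rho> from the origin to a point of the circle turns \<rho> into a representing pair of a
  positive definite extension, that is, of \<Gamma>. The circle part vanishes, hence so did the atom.
\<close>

lemma representing_measure_imp_representing_pair:
  assumes PDE: "PDE \<gamma> = {\<Gamma>}" and \<rho>: "representing_measure \<gamma> \<rho>"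
  shows "emeasure \<rho> {0} = 0" "representing_pair \<Gamma> (\<rho>, zero_circle_measure)"
proof -
  define c where "c = measure \<rho> {0}"
  define \<nu> where "\<nu> = circle_atom c 1"
  have c: "c \<ge> 0" by (simp add: c_def)
  have sets: "sets \<rho> = sets borel" using \<rho> by (simp add: representing_measure_def)
  have mp: "moment_pair (off_origin \<rho>) \<nu>" unfolding \<nu>_def
    by (rule moment_pair_off_origin[OF \<rho> c]) simp
  hence "pair_moments (off_origin \<rho>) \<nu> \<in> PDE \<gamma>"
    using pair_moments_off_origin[OF \<rho>, of 1] by (simp add: pair_moments_in_PDE_iff \<nu>_def c_def)
  hence "representing_pair \<Gamma> (off_origin \<rho>, \<nu>)"
    using PDE mp by (simp add: representing_pair_iff)
  moreover from this have \<nu>0: "\<nu> = zero_circle_measure" by (rule PDE_singleton_imp_no_circle_part[OF PDE])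
  moreover have "ennreal c = 0"
    using circle_atom(4)[OF c, of 1] \<nu>0 by (simp add: \<nu>_def)
  moreover have "emeasure \<rho> {0} = ennreal c"
  proof -
    have "integrable \<rho> (zmono 0 0)" using \<rho> by (auto simp: representing_measure_def NN_def)
    hence "integrable \<rho> (\<lambda>_. 1::complex)" by (simp only: zmono_0_0)
    hence "emeasure \<rho> (space \<rho>) < \<infinity>" by (auto simp: integrable_iff_bounded)
    thus ?thesis unfolding c_def using emeasure_space[of \<rho> "{0}"]
      by (intro emeasure_eq_ennreal_measure) (auto simp: top_unique)
  qed
  ultimately show "emeasure \<rho> {0} = 0" "representing_pair \<Gamma> (\<rho>, zero_circle_measure)"
    using off_origin_eq[OF sets] by simp_all
qed

lemma representing_pair_imp_representing_measure:
  assumes rep: "representing_pair \<Gamma> (\<mu>, zero_circle_measure)" and \<gamma>: "\<And>x. x \<in> NN \<Longrightarrow> \<Gamma> x = \<gamma> x"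
  shows "representing_measure \<gamma> \<mu>"
proof -
  have sets: "sets \<mu> = sets borel" and null: "emeasure \<mu> {0} = 0"
    and int: "\<And>m n. (m, n) \<in> NN_plus \<Longrightarrow> set_integrable \<mu> (- {0}) (zmono m n)"
    and val: "\<And>m n. (m, n) \<in> NN_plus \<Longrightarrow> \<Gamma> (m, n) = (LINT z:- {0}|\<mu>. zmono m n z)"
    using rep by (auto simp: representing_pair_def)
  note [measurable_cong] = sets
  have "{0} \<in> null_sets \<mu>" using sets null by (auto simp: null_sets_def)
  hence ae: "AE z in \<mu>. zmono m n z = indicator (- {0}) z *\<^sub>R zmono m n z" for m n
    by (rule AE_I'[of "{0}"]) (auto split: split_indicator)
  have "integrable \<mu> (zmono m n) \<longleftrightarrow> set_integrable \<mu> (- {0}) (zmono m n)" for m n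
    unfolding set_integrable_def using ae by (intro integrable_cong_AE) auto
  moreover have "(LINT z|\<mu>. zmono m n z) = (LINT z:- {0}|\<mu>. zmono m n z)" for m n
    unfolding set_lebesgue_integral_def using ae by (intro integral_cong_AE) auto
  ultimately show ?thesis
    using int val sets \<gamma> NN_subset_NN_plus unfolding representing_measure_def by fastforce
qed

lemma positive_definite_imp_representing_pair:
  assumes PD: "positive_definite \<Gamma>"
  obtains \<rho> \<nu> where "representing_measure \<Gamma> \<rho>" "representing_pair \<Gamma> (off_origin \<rho>, \<nu>)"
    "emeasure \<nu> (space \<nu>) = emeasure \<rho> {0}"
proof -
  from PD obtain \<rho> \<nu> where \<rho>: "representing_measure \<Gamma> \<rho>"
    and *: "sets \<nu> = sets (restrict_space borel unit_circle)" "emeasure \<nu> (space \<nu>) = emeasure \<rho> {0}"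
     "\<And>m n. (m, n) \<in> NN_plus \<Longrightarrow> set_integrable \<rho> (- {0}) (zmono m n)"
     "\<And>m n. integrable \<nu> (zmono m n)"
     "\<And>m n. (m, n) \<in> NN_plus \<Longrightarrow>
      \<Gamma> (m, n) = (LINT z:- {0}|\<rho>. zmono m n z) + (if m + n = 0 then 1 else 0) * (LINT z|\<nu>. zmono m n z)"
    by (rule positive_definite_imp_representing) blast
  have sets: "sets \<rho> = sets borel" using \<rho> by (simp add: representing_measure_def)
  have "representing_pair \<Gamma> (off_origin \<rho>, \<nu>)"
    unfolding representing_pair_def using *
    by (auto simp: sets emeasure_off_origin[OF sets] set_integrable_off_origin[OF sets]
        set_integral_off_origin[OF sets])
  with \<rho> *(2) show ?thesis using that by blast
qed

lemma PDE_singleton_imp_representing_measure: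
  assumes PDE: "PDE \<gamma> = {\<Gamma>}"
  obtains \<rho> where "representing_measure \<gamma> \<rho>"
proof -
  have \<Gamma>: "positive_definite \<Gamma>" "\<And>x. x \<in> NN \<Longrightarrow> \<Gamma> x = \<gamma> x" using PDE by (auto simp: PDE_def)
  obtain \<rho> where "representing_measure \<Gamma> \<rho>"
    using positive_definite_imp_representing_pair[OF \<Gamma>(1)] by blast
  hence "representing_measure \<gamma> \<rho>" using \<Gamma>(2) by (fastforce simp: representing_measure_def)
  thus ?thesis by (rule that)
qed

text \<open>
  Any extension comes from a measure that represents \<gamma>, and this can only be \<mu>.
\<close>

lemma determinate_imp_PDE_singleton:
  assumes det: "determinate_moment_seq \<gamma>" and \<mu>: "representing_measure \<gamma> \<mu>" and null: "emeasure \<mu> {0} = 0"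
  shows "PDE \<gamma> = {pair_moments \<mu> zero_circle_measure}"
proof -
  have sets: "sets \<mu> = sets borel" and int: "\<And>m n. (m, n) \<in> NN \<Longrightarrow> integrable \<mu> (zmono m n)"
    using \<mu> by (auto simp: representing_measure_def)
  have mp: "moment_pair \<mu> zero_circle_measure"
    using sets null set_integrable_zmono[OF sets int] by (auto simp: moment_pair_zero_iff)
  have "pair_moments \<mu> zero_circle_measure x = \<gamma> x" if x: "x \<in> NN" for x
  proof -
    obtain m n where mn: "x = (m, n)" by fastforce
    have "measure \<mu> {0} = 0" using null by (simp add: measure_def)
    thus ?thesis using representing_measure_integral_split[OF \<mu>, of m n] x NN_subset_NN_plus
      by (auto simp: mn pair_moments_def)
  qed
  hence "pair_moments \<mu> zero_circle_measure \<in> PDE \<gamma>" using pair_moments_in_PDE_iff[OF mp] by blast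
  moreover have "\<Gamma> = pair_moments \<mu> zero_circle_measure" if \<Gamma>: "\<Gamma> \<in> PDE \<gamma>" for \<Gamma>
  proof -
    have \<Gamma>': "\<Gamma> \<in> extensional NN_plus" "positive_definite \<Gamma>" "\<And>x. x \<in> NN \<Longrightarrow> \<Gamma> x = \<gamma> x"
      using \<Gamma> by (auto simp: PDE_def)
    obtain \<rho> \<nu> where \<rho>: "representing_measure \<Gamma> \<rho>" "representing_pair \<Gamma> (off_origin \<rho>, \<nu>)"
      "emeasure \<nu> (space \<nu>) = emeasure \<rho> {0}"
      using positive_definite_imp_representing_pair[OF \<Gamma>'(2)] by blast
    have "representing_measure \<gamma> \<rho>" using \<rho>(1) \<Gamma>'(3) by (fastforce simp: representing_measure_def)
    hence "\<rho> = \<mu>" using det \<mu> by (auto simp: determinate_moment_seq_def)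
    have "sets \<nu> = sets (restrict_space borel unit_circle)" using \<rho>(2) by (simp add: representing_pair_def)
    hence "\<nu> = zero_circle_measure"
      using \<rho>(3) null \<open>\<rho> = \<mu>\<close> by (intro zero_mass_imp_zero_circle_measure) auto
    hence "representing_pair \<Gamma> (\<mu>, zero_circle_measure)"
      using \<rho>(2) \<open>\<rho> = \<mu>\<close> off_origin_eq[OF sets null] by simp
    hence eq: "\<And>x. x \<in> NN_plus \<Longrightarrow> \<Gamma> x = pair_moments \<mu> zero_circle_measure x"
      by (simp add: representing_pair_iff)
    show ?thesis
      by (rule extensionalityI[OF \<Gamma>'(1) _ eq]) (simp_all only: pair_moments_def restrict_extensional)
  qed
  ultimately show ?thesis by blast
qed

lemma representing_pairs_unique_iff_determinate:
  assumes PDE: "PDE \<gamma> = {\<Gamma>}"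
  shows "(\<forall>\<mu>1 \<mu>2. representing_pair \<Gamma> (\<mu>1, zero_circle_measure)
            \<and> representing_pair \<Gamma> (\<mu>2, zero_circle_measure) \<longrightarrow> \<mu>1 = \<mu>2) \<longleftrightarrow> determinate_on_NN_plus \<Gamma>"
proof
  assume unique: "\<forall>\<mu>1 \<mu>2. representing_pair \<Gamma> (\<mu>1, zero_circle_measure)
            \<and> representing_pair \<Gamma> (\<mu>2, zero_circle_measure) \<longrightarrow> \<mu>1 = \<mu>2"
  obtain \<rho> where "representing_measure \<gamma> \<rho>" using PDE_singleton_imp_representing_measure[OF PDE] .
  hence rep: "representing_pair \<Gamma> (\<rho>, zero_circle_measure)"
    by (rule representing_measure_imp_representing_pair(2)[OF PDE])
  show "determinate_on_NN_plus \<Gamma>" unfolding determinate_on_NN_plus_def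
  proof (rule ex1I[of _ "(\<rho>, zero_circle_measure)"])
    show "representing_pair \<Gamma> (\<rho>, zero_circle_measure)" by (rule rep)
    fix P assume P: "representing_pair \<Gamma> P"
    obtain \<mu> \<nu> where P_eq: "P = (\<mu>, \<nu>)" by fastforce
    have "\<nu> = zero_circle_measure" using PDE_singleton_imp_no_circle_part[OF PDE] P P_eq by blast
    thus "P = (\<rho>, zero_circle_measure)" using unique rep P P_eq by blast
  qed
next
  assume "determinate_on_NN_plus \<Gamma>"
  thus "\<forall>\<mu>1 \<mu>2. representing_pair \<Gamma> (\<mu>1, zero_circle_measure)
            \<and> representing_pair \<Gamma> (\<mu>2, zero_circle_measure) \<longrightarrow> \<mu>1 = \<mu>2"
    unfolding determinate_on_NN_plus_def by blast
qed

lemma determinate_iff_PDE_singleton: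
  "(determinate_moment_seq \<gamma> \<and> (\<exists>\<mu>. representing_measure \<gamma> \<mu> \<and> emeasure \<mu> {0} = 0)) \<longleftrightarrow>
    (\<exists>\<Gamma>. PDE \<gamma> = {\<Gamma>} \<and>
       (\<forall>\<mu>1 \<mu>2. representing_pair \<Gamma> (\<mu>1, zero_circle_measure)
               \<and> representing_pair \<Gamma> (\<mu>2, zero_circle_measure) \<longrightarrow> \<mu>1 = \<mu>2))"
proof (intro iffI; elim conjE exE)
  fix \<mu> assume det: "determinate_moment_seq \<gamma>" and \<mu>: "representing_measure \<gamma> \<mu>" "emeasure \<mu> {0} = 0"
  define \<Gamma> where "\<Gamma> = pair_moments \<mu> zero_circle_measure"
  have PDE: "PDE \<gamma> = {\<Gamma>}" unfolding \<Gamma>_def by (rule determinate_imp_PDE_singleton[OF det \<mu>])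
  hence "\<And>x. x \<in> NN \<Longrightarrow> \<Gamma> x = \<gamma> x" by (auto simp: PDE_def)
  hence "representing_measure \<gamma> \<mu>'" if "representing_pair \<Gamma> (\<mu>', zero_circle_measure)" for \<mu>'
    using representing_pair_imp_representing_measure[OF that] by blast
  with det PDE show "\<exists>\<Gamma>. PDE \<gamma> = {\<Gamma>} \<and> (\<forall>\<mu>1 \<mu>2. representing_pair \<Gamma> (\<mu>1, zero_circle_measure)
               \<and> representing_pair \<Gamma> (\<mu>2, zero_circle_measure) \<longrightarrow> \<mu>1 = \<mu>2)"
    unfolding determinate_moment_seq_def by blast
next
  fix \<Gamma> assume PDE: "PDE \<gamma> = {\<Gamma>}"
    and unique: "\<forall>\<mu>1 \<mu>2. representing_pair \<Gamma> (\<mu>1, zero_circle_measure)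
               \<and> representing_pair \<Gamma> (\<mu>2, zero_circle_measure) \<longrightarrow> \<mu>1 = \<mu>2"
  obtain \<rho> where \<rho>: "representing_measure \<gamma> \<rho>" using PDE_singleton_imp_representing_measure[OF PDE] .
  moreover have "emeasure \<rho> {0} = 0" by (rule representing_measure_imp_representing_pair(1)[OF PDE \<rho>])
  moreover have "determinate_moment_seq \<gamma>"
    using \<rho> unique representing_measure_imp_representing_pair(2)[OF PDE]
    unfolding determinate_moment_seq_def complex_moment_seq_def by blast
  ultimately show "determinate_moment_seq \<gamma> \<and> (\<exists>\<mu>. representing_measure \<gamma> \<mu> \<and> emeasure \<mu> {0} = 0)"
    by blast
qed

theorem theorem6:
  fixes \<gamma> :: "int \<times> int \<Rightarrow> complex"
  shows "((determinate_moment_seq \<gamma> \<and> (\<exists>\<mu>. representing_measure \<gamma> \<mu> \<and> emeasure \<mu> {0} = 0))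
            \<longleftrightarrow>
          (\<exists>\<Gamma>. PDE \<gamma> = {\<Gamma>} \<and>
             (\<forall>\<mu>1 \<mu>2. representing_pair \<Gamma> (\<mu>1, zero_circle_measure)
                     \<and> representing_pair \<Gamma> (\<mu>2, zero_circle_measure) \<longrightarrow> \<mu>1 = \<mu>2)))
       \<and> ((\<exists>\<Gamma>. PDE \<gamma> = {\<Gamma>} \<and>
             (\<forall>\<mu>1 \<mu>2. representing_pair \<Gamma> (\<mu>1, zero_circle_measure)
                     \<and> representing_pair \<Gamma> (\<mu>2, zero_circle_measure) \<longrightarrow> \<mu>1 = \<mu>2))
            \<longleftrightarrow>
          (\<exists>\<Gamma>. PDE \<gamma> = {\<Gamma>} \<and> determinate_on_NN_plus \<Gamma>))
       \<and> (\<forall>\<Gamma> \<mu>. PDE \<gamma> = {\<Gamma>} \<and> determinate_on_NN_plus \<Gamma>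
             \<and> determinate_moment_seq \<gamma> \<and> representing_measure \<gamma> \<mu> \<and> emeasure \<mu> {0} = 0
             \<longrightarrow> representing_pair \<Gamma> (\<mu>, zero_circle_measure))"
proof (intro conjI allI impI)
  show "(determinate_moment_seq \<gamma> \<and> (\<exists>\<mu>. representing_measure \<gamma> \<mu> \<and> emeasure \<mu> {0} = 0))
            \<longleftrightarrow>
          (\<exists>\<Gamma>. PDE \<gamma> = {\<Gamma>} \<and>
             (\<forall>\<mu>1 \<mu>2. representing_pair \<Gamma> (\<mu>1, zero_circle_measure)
                     \<and> representing_pair \<Gamma> (\<mu>2, zero_circle_measure) \<longrightarrow> \<mu>1 = \<mu>2))"
    by (rule determinate_iff_PDE_singleton)
  show "(\<exists>\<Gamma>. PDE \<gamma> = {\<Gamma>} \<and>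
             (\<forall>\<mu>1 \<mu>2. representing_pair \<Gamma> (\<mu>1, zero_circle_measure)
                     \<and> representing_pair \<Gamma> (\<mu>2, zero_circle_measure) \<longrightarrow> \<mu>1 = \<mu>2))
            \<longleftrightarrow>
          (\<exists>\<Gamma>. PDE \<gamma> = {\<Gamma>} \<and> determinate_on_NN_plus \<Gamma>)"
    by (intro arg_cong[of _ _ Ex] ext conj_cong refl representing_pairs_unique_iff_determinate)
  fix \<Gamma> \<mu>
  assume "PDE \<gamma> = {\<Gamma>} \<and> determinate_on_NN_plus \<Gamma>
             \<and> determinate_moment_seq \<gamma> \<and> representing_measure \<gamma> \<mu> \<and> emeasure \<mu> {0} = 0"
  thus "representing_pair \<Gamma> (\<mu>, zero_circle_measure)"
    using representing_measure_imp_representing_pair(2) by blast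
qed

end
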